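(* Let $\alpha_0$ be a real irrational quadratic integer over $\mathbb{Q}$, and let $\mathcal{O}=\mathbb{Z}+\alpha_0\mathbb{Z}$ be the order it defines in $\mathbb{Q}(\alpha_0)$. Let $D=\operatorname{Tr}(\alpha_0)^2-4N(\alpha_0)$ be the discriminant of $\mathcal{O}$, let $(t_0,u_0)$ be the fundamental solution of the Pell–Fermat equation $t^2-Du^2=4$, let $\epsilon_0=\frac{t_0+u_0\sqrt{D}}{2}$ and $R_0=\log\epsilon_0$. Let $n_0=2$ if $\mathcal{O}$ contains a unit of norm $-1$, and $n_0=1$ otherwise. Then, as $t\to+\infty$, $$\operatorname{Card}\big(\{\alpha\in\operatorname{PSL}_2(\mathbb{Z})\cdot\{\alpha_0,\alpha_0^\sigma\}\ \operatorname{mod}\ \mathbb{Z}\;:\;|\alpha-\alpha^\sigma|^{-1}\leq t\}\big)\sim\frac{24\,R_0}{\pi^2 n_0}\;t .$$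
   Context: For a real quadratic irrational $\alpha$ over $\mathbb{Q}$, $\alpha^\sigma$ denotes its Galois conjugate, $\operatorname{Tr}(\alpha)=\alpha+\alpha^\sigma$ and $N(\alpha)=\alpha\alpha^\sigma$. The group $\operatorname{PSL}_2(\mathbb{Z})$ acts on $\mathbb{R}\cup\{\infty\}$ by homographies. "mod $\mathbb{Z}$" means that elements $\alpha$ of the orbit are counted modulo translations by integers; $|\alpha-\alpha^\sigma|$ is invariant under these. The fundamental solution $(t_0,u_0)$ is the integer solution with $t_0,u_0>0$ and $u_0$ minimal. *)

theory Defs
  imports "HOL-Analysis.Analysis" "HOL-Library.Landau_Symbols"
begin

definition quadratic_integer :: "real \<Rightarrow> bool" where
  "quadratic_integer x \<longleftrightarrow> (\<exists>b c :: int. x\<^sup>2 + of_int b * x + of_int c = 0)"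

text \<open>
  For a quadratic irrational, the Galois conjugate is the other element with the same
  annihilating polynomials over the rationals, i.e. the other root of the minimal polynomial.
  Rational numbers are fixed, so that on a real quadratic field this is the nontrivial
  field automorphism. The value is only meaningful on numbers of degree at most 2 whose
  conjugates are real.
\<close>
definition galois_conj :: "real \<Rightarrow> real" where
  "galois_conj x =
     (if x \<in> \<rat> then x
      else THE y. y \<noteq> x \<and>
             (\<forall>p :: real poly. (\<forall>i. coeff p i \<in> \<rat>) \<longrightarrow> poly p x = 0 \<longrightarrow> poly p y = 0))"

definition Tr :: "real \<Rightarrow> real" where
  "Tr x = x + galois_conj x"

definition Nm :: "real \<Rightarrow> real" where
  "Nm x = x * galois_conj x"

definition order_of :: "real \<Rightarrow> real set" where
  "order_of x = {of_int a + of_int b * x | a b :: int. True}"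

definition disc :: "real \<Rightarrow> real" where
  "disc x = (Tr x)\<^sup>2 - 4 * Nm x"

definition has_unit_of_norm_minus_one :: "real set \<Rightarrow> bool" where
  "has_unit_of_norm_minus_one R \<longleftrightarrow> (\<exists>u\<in>R. (\<exists>v\<in>R. u * v = 1) \<and> Nm u = -1)"

definition pell_solution :: "real \<Rightarrow> int \<Rightarrow> int \<Rightarrow> bool" where
  "pell_solution D t u \<longleftrightarrow> (of_int t)\<^sup>2 - D * (of_int u)\<^sup>2 = 4"

definition fundamental_pell_solution :: "real \<Rightarrow> int \<Rightarrow> int \<Rightarrow> bool" where
  "fundamental_pell_solution D t u \<longleftrightarrow>
     t > 0 \<and> u > 0 \<and> pell_solution D t u \<and>
     (\<forall>t' u'. t' > 0 \<and> u' > 0 \<and> pell_solution D t' u' \<longrightarrow> u \<le> u')"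

definition SL2Z :: "(int ^ 2 ^ 2) set" where
  "SL2Z = {A. det A = 1}"

text \<open>
  Only applied to irrational points, where the denominator does not vanish for a matrix in
  \<open>SL2Z\<close>; in particular the point at infinity is never reached.
\<close>
definition homography :: "int ^ 2 ^ 2 \<Rightarrow> real \<Rightarrow> real" where
  "homography A x =
     (of_int (A $ 1 $ 1) * x + of_int (A $ 1 $ 2)) / (of_int (A $ 2 $ 1) * x + of_int (A $ 2 $ 2))"

text \<open>
  Opposite matrices define the same homography, so the orbits of \<open>PSL2(Z)\<close> are
  those of \<open>SL2Z\<close>.
\<close>
definition PSL2Z_orbit :: "real set \<Rightarrow> real set" where
  "PSL2Z_orbit S = {homography A x | A x. A \<in> SL2Z \<and> x \<in> S}"

definition mod_Z :: "(real \<times> real) set" where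
  "mod_Z = {(x, y). x - y \<in> \<int>}"

end

theory Submission
  imports Defs
begin

text \<open>
Write \<open>\<beta>\<close> for the conjugate of \<open>\<alpha>\<^sub>0\<close>, so that \<open>D = (\<alpha>\<^sub>0 - \<beta>)\<^sup>2\<close>. If \<open>w\<close> is the image of \<open>\<alpha>\<^sub>0\<close> under a
matrix of determinant \<open>1\<close> with bottom row \<open>(c, d)\<close>, then \<open>w - galois_conj w\<close> is \<open>\<alpha>\<^sub>0 - \<beta>\<close> divided by
the norm of \<open>c \<alpha>\<^sub>0 + d\<close>. The top row matters only for the translate of \<open>w\<close>, and two bottom
rows give the same class modulo \<open>\<int>\<close> exactly when the elements \<open>c \<alpha>\<^sub>0 + d\<close> differ by a unit
of norm \<open>1\<close>. Hence the classes in the orbit of \<open>\<alpha>\<^sub>0\<close> correspond to the primitive elements of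
the order, modulo units of norm \<open>1\<close>, whose norm is at most \<open>t sqrt D\<close> in absolute value
(\<open>primitive_points_bij_classes\<close>).

These units are \<open>\<plusminus> \<epsilon>\<^sub>0\<^sup>k\<close>, so a representative can be chosen with
\<open>x = c \<alpha>\<^sub>0 + d > 0\<close>, \<open>y = c \<beta> + d\<close> and \<open>1 \<le> \<bar>x / y\<bar> < \<epsilon>\<^sub>0\<^sup>2\<close>. This sector is a cone, and its
part with \<open>\<bar>x y\<bar> \<le> 1\<close> has area \<open>2 R\<^sub>0\<close>. As the order has covolume \<open>sqrt D\<close>, there are about
\<open>2 R\<^sub>0 T / sqrt D\<close> elements of the order in the sector with norm at most \<open>T\<close>
(\<open>points_asymptotics\<close>, from the general count \<open>lattice_points_scaled_region\<close>). Restricting to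
primitive ones divides this by \<open>\<zeta>(2) = \<pi>\<^sup>2 / 6\<close> (\<open>tendsto_primitive_count\<close>), so with
\<open>T = t sqrt D\<close> each of the two orbits contributes \<open>12 R\<^sub>0 t / \<pi>\<^sup>2\<close> (\<open>classes_asymptotics\<close>).

Finally, conjugation is the matrix \<open>z \<mapsto> tr - z\<close> of determinant \<open>- 1\<close>. Therefore the orbits of
\<open>\<alpha>\<^sub>0\<close> and \<open>\<beta>\<close> coincide if some integer matrix of determinant \<open>- 1\<close> fixes \<open>\<alpha>\<^sub>0\<close>, which
amounts to a unit of norm \<open>- 1\<close>, and are disjoint otherwise
(\<open>orbit_subset_of_unit\<close>, \<open>unit_of_orbits_meeting\<close>). This is the factor \<open>n\<^sub>0\<close>.
\<close>

section \<open>Removing common factors from a count\<close>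

text \<open>
What matters is that \<open>\<zeta>(2) - 1\<close> lies strictly below \<open>1\<close>: this makes the recursion below a
contraction. Bounding \<open>1 / (k + 2)\<^sup>2\<close> by \<open>1 / (k + 1) - 1 / (k + 2)\<close> from the second
term on gives \<open>3/4\<close>.
\<close>
lemma squares_tail_bound:
  "summable (\<lambda>k. 1 / (real k + 1)\<^sup>2)" "(\<Sum>k. 1 / (real (Suc k) + 1)\<^sup>2) \<le> 3/4"
proof -
  have sums: "(\<lambda>k. 1 / (real k + 1)\<^sup>2) sums (pi\<^sup>2 / 6)"
    using inverse_squares_sums by (simp add: add.commute)
  show sm: "summable (\<lambda>k. 1 / (real k + 1)\<^sup>2)"
    using sums by (rule sums_summable)
  have sm1: "summable (\<lambda>k. 1 / (real (Suc k) + 1)\<^sup>2)"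
    using sm summable_Suc_iff[of "\<lambda>k. 1 / (real k + 1)\<^sup>2"] by simp
  have part: "(\<Sum>k<m. 1 / (real (Suc k) + 1)\<^sup>2) \<le> 3/4 - 1 / (real m + 1)" if "m \<ge> 1" for m
    using that
  proof (induction m rule: dec_induct)
    case base
    then show ?case by (simp add: power2_eq_square)
  next
    case (step m)
    have "1 / (real m + 2)\<^sup>2 \<le> 1 / ((real m + 1) * (real m + 2))"
      by (intro divide_left_mono mult_pos_pos zero_less_power) (auto simp: power2_eq_square algebra_simps)
    also have "\<dots> = 1 / (real m + 1) - 1 / (real m + 2)"
      by (simp add: field_simps)
    finally show ?case using step by (simp add: algebra_simps)
  qed
  show "(\<Sum>k. 1 / (real (Suc k) + 1)\<^sup>2) \<le> 3/4"
  proof (rule suminf_le_const[OF sm1])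
    fix m
    show "(\<Sum>k<m. 1 / (real (Suc k) + 1)\<^sup>2) \<le> 3/4"
    proof (cases "m \<ge> 1")
      case True
      have "0 \<le> 1 / (real m + 1)" by simp
      then show ?thesis using part[OF True] by linarith
    next
      case False
      then have "m = 0" by simp
      then show ?thesis by simp
    qed
  qed
qed

text \<open>
The error \<open>q\<close> at \<open>T\<close> is \<open>r T\<close> minus the weighted errors at \<open>T / k\<^sup>2\<close>, \<open>k \<ge> 2\<close>, whose
weights add up to at most \<open>3/4\<close>. For \<open>T\<close> large the bound \<open>M\<close> applies to the
finitely many arguments with \<open>k \<le> K\<close>, and the tail is negligible by the global bound \<open>B\<close>.
So an eventual bound \<open>M\<close> improves to \<open>3/4 * M + M/16 + M/16 = 7/8 * M\<close>.
\<close>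
lemma sieve_contraction:
  fixes q r :: "real \<Rightarrow> real"
  assumes sums: "\<And>T. T > 0 \<Longrightarrow> (\<lambda>k. q (T / (real k + 1)\<^sup>2) / (real k + 1)\<^sup>2) sums r T"
    and bound: "\<And>T. T > 0 \<Longrightarrow> \<bar>q T\<bar> \<le> B"
    and r: "(r \<longlongrightarrow> 0) at_top"
    and M: "M > 0" "eventually (\<lambda>T. \<bar>q T\<bar> \<le> M) at_top"
  shows "eventually (\<lambda>T. \<bar>q T\<bar> \<le> 7/8 * M) at_top"
proof -
  let ?w = "\<lambda>k. 1 / (real k + 1)\<^sup>2"
  have B: "B \<ge> 0" using bound[of 1] by linarith
  obtain T0 where T0: "\<And>T. T \<ge> T0 \<Longrightarrow> \<bar>q T\<bar> \<le> M"
    using M(2) by (auto simp: eventually_at_top_linorder)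
  have "(\<lambda>K. B * (\<Sum>k. ?w (k + K))) \<longlonglongrightarrow> B * 0"
    by (intro tendsto_mult tendsto_const suminf_exist_split2 squares_tail_bound)
  then have "eventually (\<lambda>K. B * (\<Sum>k. ?w (k + K)) < M / 16) sequentially"
    using order_tendstoD(2)[of _ "B * 0" sequentially "M / 16"] M(1) by simp
  then have "eventually (\<lambda>K. B * (\<Sum>k. ?w (k + K)) < M / 16 \<and> K \<ge> 1) sequentially"
    using eventually_ge_at_top by (rule eventually_conj)
  then obtain K where K: "B * (\<Sum>k. ?w (k + K)) < M / 16" "K \<ge> 1"
    by (auto simp: eventually_sequentially)
  have ev_r: "eventually (\<lambda>T. \<bar>r T\<bar> < M / 16) at_top"
    using r M(1) tendsto_rabs_zero_iff[of r at_top] order_tendstoD(2)[of "\<lambda>T. \<bar>r T\<bar>" 0 at_top "M/16"] by simp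
  show ?thesis
    using ev_r eventually_gt_at_top[of 0] eventually_ge_at_top[of "T0 * (real K + 1)\<^sup>2"] 
      eventually_ge_at_top[of T0]
  proof eventually_elim
    case (elim T)
    let ?f = "\<lambda>k. q (T / (real k + 1)\<^sup>2) / (real k + 1)\<^sup>2"
    have abs_le: "\<bar>?f k\<bar> \<le> B * ?w k" for k
      using bound[of "T / (real k + 1)\<^sup>2"] elim(2) by (simp add: abs_divide divide_right_mono)
    have small: "\<bar>?f k\<bar> \<le> M * ?w k" if "k < K" for k
    proof -
      have "T0 \<le> T / (real k + 1)\<^sup>2"
      proof (cases "T0 \<le> 0")
        case True
        then show ?thesis using elim(2) by (smt (verit) divide_nonneg_nonneg zero_le_power2)
      next
        case False
        have "T0 * (real k + 1)\<^sup>2 \<le> T0 * (real K + 1)\<^sup>2"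
          using that False by (intro mult_left_mono power_mono) auto
        then show ?thesis using elim(3) by (simp add: pos_le_divide_eq)
      qed
      then show ?thesis using T0 by (simp add: abs_divide divide_right_mono)
    qed
    have smf: "summable ?f" using sums[OF elim(2)] by (rule sums_summable)
    have sma: "summable (\<lambda>k. \<bar>?f k\<bar>)"
      by (rule summable_comparison_test[of _ "\<lambda>k. B * ?w k"])
        (use abs_le summable_mult[OF squares_tail_bound(1), of B] in auto)
    have "r T = suminf ?f" using sums[OF elim(2)] by (rule sums_unique)
    also have "\<dots> = q T + (\<Sum>k. ?f (k + 1))"
      using suminf_split_initial_segment[OF smf, of 1] by simp
    finally have "\<bar>q T\<bar> \<le> \<bar>r T\<bar> + \<bar>\<Sum>k. ?f (k + 1)\<bar>" by linarith
    also have "\<bar>\<Sum>k. ?f (k + 1)\<bar> \<le> (\<Sum>k. \<bar>?f (k + 1)\<bar>)"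
      by (intro summable_rabs summable_ignore_initial_segment[OF sma])
    also have "\<dots> = (\<Sum>k. \<bar>?f (k + K)\<bar>) + (\<Sum>k = 1..<K. \<bar>?f k\<bar>)"
    proof -
      have "{..<K} = insert 0 {1..<K}" using K(2) by auto
      then have "(\<Sum>k<K. \<bar>?f k\<bar>) = \<bar>?f 0\<bar> + (\<Sum>k = 1..<K. \<bar>?f k\<bar>)" by simp
      then show ?thesis
        using suminf_split_initial_segment[OF sma, of 1] suminf_split_initial_segment[OF sma, of K]
        by simp
    qed
    also have "(\<Sum>k. \<bar>?f (k + K)\<bar>) \<le> (\<Sum>k. B * ?w (k + K))"
      using sma by (intro suminf_le abs_le summable_mult)
        (simp_all only: summable_iff_shift[of "\<lambda>k. \<bar>?f k\<bar>"] summable_iff_shift[of ?w] squares_tail_bound)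
    also have "\<dots> = B * (\<Sum>k. ?w (k + K))"
      by (intro suminf_mult) (simp only: summable_iff_shift[of ?w] squares_tail_bound)
    also have "(\<Sum>k = 1..<K. \<bar>?f k\<bar>) \<le> (\<Sum>k = 1..<K. M * ?w k)"
      by (intro sum_mono small) auto
    also have "\<dots> = M * (\<Sum>k < K - 1. ?w (Suc k))"
      unfolding sum_distrib_left[symmetric]
      by (intro arg_cong[of _ _ "(*) M"] sum.reindex_bij_witness[of _ Suc "\<lambda>k. k - 1"]) auto
    also have "(\<Sum>k < K - 1. ?w (Suc k)) \<le> (\<Sum>k. ?w (Suc k))"
      by (intro sum_le_suminf) (auto simp only: summable_Suc_iff[of ?w] squares_tail_bound, auto)
    also have "\<dots> \<le> 3/4" by (rule squares_tail_bound)
    finally show ?case using K(1) M(1) elim(1) by simp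
  qed
qed

text \<open>
If \<open>N\<close> counts all vectors of a cone up to size \<open>T\<close>, where the size is homogeneous of degree \<open>2\<close>,
and \<open>P\<close> the primitive ones, then sorting by the greatest common divisor gives
\<open>N T = (\<Sum>k\<ge>1. P (T / k\<^sup>2))\<close>. Instead of inverting this relation with the Moebius function,
subtract the expected main term \<open>c * T\<close> with \<open>c * \<zeta>(2) = A\<close> and iterate the contraction above.
\<close>
lemma tendsto_primitive_count:
  fixes N P :: "real \<Rightarrow> real"
  assumes sums: "\<And>T. T > 0 \<Longrightarrow> (\<lambda>k. P (T / (real k + 1)\<^sup>2)) sums N T"
    and nonneg: "\<And>T. P T \<ge> 0"
    and small: "\<And>T. T < 1 \<Longrightarrow> P T = 0"
    and mono: "mono P"
    and N: "((\<lambda>T. N T / T) \<longlongrightarrow> A) at_top"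
  shows "((\<lambda>T. P T / T) \<longlongrightarrow> 6 / pi\<^sup>2 * A) at_top"
proof -
  define c where "c = 6 / pi\<^sup>2 * A"
  define q where "q T = P T / T - c" for T
  have PN: "P T \<le> N T" if "T > 0" for T
    using sum_le_suminf[OF sums_summable[OF sums[OF that]], of "{0}"] sums_unique[OF sums[OF that]] nonneg
    by simp
  have sq: "(\<lambda>k. 1 / (real k + 1)\<^sup>2) sums (pi\<^sup>2 / 6)"
    using inverse_squares_sums by (simp add: add.commute)
  have qsums: "(\<lambda>k. q (T / (real k + 1)\<^sup>2) / (real k + 1)\<^sup>2) sums (N T / T - A)" if "T > 0" for T
  proof -
    have "(\<lambda>k. P (T / (real k + 1)\<^sup>2) / T - c * (1 / (real k + 1)\<^sup>2)) sums (N T / T - c * (pi\<^sup>2/6))"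
      by (intro sums_diff sums_divide sums_mult sums sq that)
    moreover have "P (T / (real k + 1)\<^sup>2) / T - c * (1 / (real k + 1)\<^sup>2)
        = q (T / (real k + 1)\<^sup>2) / (real k + 1)\<^sup>2" for k
    proof -
      have "(real k + 1)\<^sup>2 \<noteq> 0" by simp
      then show ?thesis using that unfolding q_def by (simp add: field_simps)
    qed
    ultimately show ?thesis by (simp add: c_def)
  qed
  obtain T1 where T1: "\<And>T. T \<ge> T1 \<Longrightarrow> N T / T < A + 1" "T1 \<ge> 1"
  proof -
    have "eventually (\<lambda>T. N T / T < A + 1 \<and> T \<ge> 1) at_top"
      using order_tendstoD(2)[OF N, of "A + 1"] eventually_ge_at_top[of 1] by (simp add: eventually_conj)
    then obtain T1 where "\<And>T. T \<ge> T1 \<Longrightarrow> N T / T < A + 1 \<and> T \<ge> 1"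
      by (auto simp: eventually_at_top_linorder)
    then show thesis using that[of T1] by auto
  qed
  define B where "B = max (A + 1) (P T1) + \<bar>c\<bar> + 1"
  have qB: "\<bar>q T\<bar> \<le> B" if "T > 0" for T
  proof -
    have "P T / T \<le> max (A + 1) (P T1)"
    proof (cases "T \<ge> T1")
      case True
      have "P T / T \<le> N T / T" using PN that by (simp add: divide_right_mono)
      then show ?thesis using T1(1)[OF True] by linarith
    next
      case False
      show ?thesis
      proof (cases "T < 1")
        case True
        then show ?thesis using small nonneg[of T1] by simp
      next
        case False
        then have "P T / T \<le> P T / 1" using nonneg by (intro divide_left_mono) auto
        also have "\<dots> \<le> P T1" using \<open>\<not> T \<ge> T1\<close> mono by (simp add: monoD)
        finally show ?thesis by simp
      qed
    qed
    moreover have "P T / T \<ge> 0" using nonneg that by simp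
    ultimately show ?thesis unfolding q_def B_def by linarith
  qed
  have Bpos: "B > 0" using nonneg[of T1] unfolding B_def by linarith
  have r0: "((\<lambda>T. N T / T - A) \<longlongrightarrow> 0) at_top"
    using N by (rule LIM_zero)
  have ev: "eventually (\<lambda>T. \<bar>q T\<bar> \<le> (7/8)^j * B) at_top" for j
  proof (induction j)
    case 0
    then show ?case using eventually_gt_at_top[of 0] by eventually_elim (use qB in auto)
  next
    case (Suc j)
    show ?case
      using sieve_contraction[OF qsums qB r0 _ Suc] Bpos by (simp add: mult.assoc)
  qed
  have "(q \<longlongrightarrow> 0) at_top"
  proof (rule tendstoI)
    fix e :: real assume e: "e > 0"
    obtain j where "(7/8::real) ^ j < e / B" using real_arch_pow_inv[of "e/B" "7/8"] e Bpos by auto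
    then have "(7/8) ^ j * B < e" using Bpos by (simp add: field_simps)
    then show "eventually (\<lambda>T. dist (q T) 0 < e) at_top"
      using ev[of j] by (auto elim!: eventually_mono)
  qed
  then show ?thesis using LIM_zero_cancel[of "\<lambda>T. P T / T" c] unfolding q_def c_def by simp
qed

section \<open>Lattice points in a dilated plane region\<close>

lemma floor_div_tendsto:
  fixes x :: real
  shows "((\<lambda>s. of_int \<lfloor>s * x\<rfloor> / s) \<longlongrightarrow> x) at_top"
proof (rule real_tendsto_sandwich[of "\<lambda>s. x - 1 / s" _ _ "\<lambda>_. x"])
  show "eventually (\<lambda>s. x - 1 / s \<le> of_int \<lfloor>s * x\<rfloor> / s) at_top"
    using eventually_gt_at_top[of 0]
  proof eventually_elim
    case (elim s)
    have "s * x - 1 \<le> of_int \<lfloor>s * x\<rfloor>" by linarith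
    then have "(s * x - 1) / s \<le> of_int \<lfloor>s * x\<rfloor> / s" using elim by (intro divide_right_mono) auto
    then show ?case using elim by (simp add: diff_divide_distrib)
  qed
  show "eventually (\<lambda>s. of_int \<lfloor>s * x\<rfloor> / s \<le> x) at_top"
    using eventually_gt_at_top[of 0]
  proof eventually_elim
    case (elim s)
    have "of_int \<lfloor>s * x\<rfloor> \<le> s * x" by linarith
    then show ?case using elim by (simp add: field_simps)
  qed
  have "((\<lambda>s. x - 1 / s) \<longlongrightarrow> x - 0) at_top"
    by (intro tendsto_intros tendsto_divide_0[OF tendsto_const] filterlim_at_top_imp_at_infinity filterlim_ident)
  then show "((\<lambda>s. x - 1 / s) \<longlongrightarrow> x) at_top" by simp
qed simp

lemma finite_lattice_points_scaled:
  fixes S :: "(real \<times> real) set"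
  assumes "bounded S" and s: "s > 0"
  shows "finite {(m :: int, n :: int). (of_int m / s, of_int n / s) \<in> S}"
proof -
  obtain b where b: "\<And>p. p \<in> S \<Longrightarrow> norm p \<le> b" using assms(1) by (auto simp: bounded_iff)
  have "{(m :: int, n :: int). (of_int m / s, of_int n / s) \<in> S}
      \<subseteq> {- \<lceil>s * b\<rceil>..\<lceil>s * b\<rceil>} \<times> {- \<lceil>s * b\<rceil>..\<lceil>s * b\<rceil>}"
  proof clarify
    fix m n :: int assume "(of_int m / s, of_int n / s) \<in> S"
    then have le: "norm (of_int m / s, of_int n / s) \<le> b" by (rule b)
    have "\<bar>of_int m / s\<bar> \<le> b" "\<bar>of_int n / s\<bar> \<le> b"
      using le norm_fst_le[of "of_int m / s :: real" "of_int n / s :: real"] 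
        norm_snd_le[of "of_int n / s :: real" "of_int m / s :: real"] by auto
    then have "\<bar>of_int m\<bar> \<le> s * b" "\<bar>of_int n\<bar> \<le> s * b"
      using s by (simp_all add: abs_divide field_simps)
    then have "\<bar>of_int m :: real\<bar> \<le> of_int \<lceil>s * b\<rceil>" "\<bar>of_int n :: real\<bar> \<le> of_int \<lceil>s * b\<rceil>"
      by linarith+
    then have "\<bar>m\<bar> \<le> \<lceil>s * b\<rceil>" "\<bar>n\<bar> \<le> \<lceil>s * b\<rceil>" by linarith+
    then show "m \<in> {- \<lceil>s * b\<rceil>..\<lceil>s * b\<rceil>} \<and> n \<in> {- \<lceil>s * b\<rceil>..\<lceil>s * b\<rceil>}" by auto
  qed
  then show ?thesis by (rule finite_subset) simp
qed

text \<open>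
Rounding a point down to the lattice \<open>(1/s) \<int>\<^sup>2\<close> is constant on half-open squares of area
\<open>1 / s\<^sup>2\<close>, so a lattice point count is the integral of an indicator function.
\<close>
lemma integral_rounded_indicator:
  fixes S :: "(real \<times> real) set"
  assumes "bounded S" and s: "s > 0"
  shows "(\<integral>p. indicator S (of_int \<lfloor>s * fst p\<rfloor> / s, of_int \<lfloor>s * snd p\<rfloor> / s) \<partial>lborel)
       = real (card {(m :: int, n :: int). (of_int m / s, of_int n / s) \<in> S}) / s\<^sup>2"
proof -
  let ?L = "{(m :: int, n :: int). (of_int m / s, of_int n / s) \<in> S}"
  let ?I = "\<lambda>m :: int. {of_int m / s..<(of_int m + 1) / s}"
  let ?Q = "\<lambda>v. ?I (fst v) \<times> ?I (snd v)"
  have fin: "finite ?L" using finite_lattice_points_scaled[OF assms] .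
  have I: "x \<in> ?I m \<longleftrightarrow> \<lfloor>s * x\<rfloor> = m" for x m
    using s by (auto simp: floor_eq_iff field_simps)
  have eq: "indicator S (of_int \<lfloor>s * fst p\<rfloor> / s, of_int \<lfloor>s * snd p\<rfloor> / s)
      = (\<Sum>v\<in>?L. indicator (?Q v) p :: real)" for p
  proof -
    have "(\<Sum>v\<in>?L. indicator (?Q v) p :: real) = (\<Sum>v\<in>?L. if v = (\<lfloor>s * fst p\<rfloor>, \<lfloor>s * snd p\<rfloor>) then 1 else 0)"
      by (rule sum.cong) (auto simp: indicator_def mem_Times_iff I simp del: atLeastLessThan_iff)
    then show ?thesis using fin by (simp add: sum.delta indicator_def)
  qed
  have em: "emeasure lborel (?Q v) = ennreal (1 / s\<^sup>2)" for v
  proof -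
    have "emeasure (lborel \<Otimes>\<^sub>M lborel) (?Q v) = emeasure lborel (?I (fst v)) * emeasure lborel (?I (snd v))"
      by (intro lborel.emeasure_pair_measure_Times) auto
    also have "\<dots> = ennreal (1 / s) * ennreal (1 / s)"
      using s by (simp add: divide_right_mono add_divide_distrib)
    also have "\<dots> = ennreal (1 / s\<^sup>2)"
      using s by (simp add: ennreal_mult[symmetric] power2_eq_square)
    finally show ?thesis by (simp add: lborel_prod)
  qed
  have Q: "?Q v \<in> sets lborel" for v
    unfolding lborel_prod[symmetric] by (intro pair_measureI) auto
  have "(\<integral>p. indicator S (of_int \<lfloor>s * fst p\<rfloor> / s, of_int \<lfloor>s * snd p\<rfloor> / s) \<partial>lborel)
      = (\<Sum>v\<in>?L. \<integral>p. (indicator (?Q v) p :: real) \<partial>lborel)"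
    unfolding eq using Q em by (intro Bochner_Integration.integral_sum integrable_real_indicator) auto
  also have "\<dots> = (\<Sum>v\<in>?L. 1 / s\<^sup>2)"
    using Q em by (intro sum.cong refl) (simp add: measure_def)
  finally show ?thesis by simp
qed

text \<open>
Off the frontier of \<open>S\<close>, rounding to a fine enough lattice does not change membership in \<open>S\<close>,
so the integrands of the previous lemma converge almost everywhere. As \<open>S\<close> is bounded, dominated
convergence applies.
\<close>
lemma lattice_points_scaled_region:
  fixes S :: "(real \<times> real) set"
  assumes bdd: "bounded S" and S [measurable]: "S \<in> sets borel"
    and fr: "frontier S \<in> null_sets lborel"
  shows "((\<lambda>s. real (card {(m :: int, n :: int). (of_int m / s, of_int n / s) \<in> S}) / s\<^sup>2)
            \<longlongrightarrow> measure lborel S) at_top"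
proof -
  let ?f = "\<lambda>s p. indicator S (of_int \<lfloor>s * fst p\<rfloor> / s, of_int \<lfloor>s * snd p\<rfloor> / s) :: real"
  obtain b where b: "\<And>p. p \<in> S \<Longrightarrow> norm p \<le> b" using bdd by (auto simp: bounded_iff)
  let ?C = "cbox (- b - 1, - b - 1) (b + 1, b + 1) :: (real \<times> real) set"
  have "((\<lambda>s. \<integral>p. ?f s p \<partial>lborel) \<longlongrightarrow> (\<integral>p. indicator S p \<partial>lborel)) at_top"
  proof (rule integral_dominated_convergence_at_top[where w = "indicator ?C"])
    show "indicator S \<in> borel_measurable lborel" by measurable
    show "?f s \<in> borel_measurable lborel" for s
    proof -
      have [measurable]: "fst \<in> borel_measurable (borel :: (real \<times> real) measure)"
        "snd \<in> borel_measurable (borel :: (real \<times> real) measure)"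
        by (intro borel_measurable_continuous_onI continuous_intros)+
      have "(\<lambda>p :: real \<times> real. (of_int \<lfloor>s * fst p\<rfloor> / s, of_int \<lfloor>s * snd p\<rfloor> / s)) \<in> borel \<rightarrow>\<^sub>M borel"
        by (intro borel_measurable_Pair; measurable)
      then show ?thesis by measurable
    qed
    show "integrable lborel (indicator ?C :: _ \<Rightarrow> real)" by (intro integrable_real_indicator emeasure_lborel_cbox_finite) auto
    show "AE p in lborel. ((\<lambda>s. ?f s p) \<longlongrightarrow> indicator S p) at_top"
      using AE_not_in[OF fr]
    proof eventually_elim
      case (elim p)
      have lim: "((\<lambda>s. (of_int \<lfloor>s * fst p\<rfloor> / s, of_int \<lfloor>s * snd p\<rfloor> / s)) \<longlongrightarrow> p) at_top"
        using tendsto_Pair[OF floor_div_tendsto[of "fst p"] floor_div_tendsto[of "snd p"]] by simp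
      show ?case
      proof (cases "p \<in> S")
        case True
        then have "p \<in> interior S" using elim by (auto simp: frontier_def closure_def)
        then have "eventually (\<lambda>s. (of_int \<lfloor>s * fst p\<rfloor> / s, of_int \<lfloor>s * snd p\<rfloor> / s) \<in> interior S) at_top"
          using lim by (auto dest: topological_tendstoD)
        then have "eventually (\<lambda>s. ?f s p = indicator S p) at_top"
          by eventually_elim (use True interior_subset in \<open>auto simp: indicator_def\<close>)
        then show ?thesis by (rule tendsto_eventually)
      next
        case False
        then have "p \<in> - closure S" using elim interior_subset by (auto simp: frontier_def)
        then have "eventually (\<lambda>s. (of_int \<lfloor>s * fst p\<rfloor> / s, of_int \<lfloor>s * snd p\<rfloor> / s) \<in> - closure S) at_top"
          using lim topological_tendstoD[OF lim, of "- closure S"] by auto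
        then have "eventually (\<lambda>s. ?f s p = indicator S p) at_top"
          by eventually_elim (use False closure_subset in \<open>auto simp: indicator_def\<close>)
        then show ?thesis by (rule tendsto_eventually)
      qed
    qed
    show "eventually (\<lambda>s. AE p in lborel. norm (?f s p) \<le> indicator ?C p) at_top"
      using eventually_ge_at_top[of 1]
    proof eventually_elim
      case (elim s)
      have "norm (?f s p) \<le> indicator ?C p" for p
      proof (cases "(of_int \<lfloor>s * fst p\<rfloor> / s, of_int \<lfloor>s * snd p\<rfloor> / s) \<in> S")
        case True
        have close: "\<bar>x\<bar> \<le> b + 1" if "\<bar>of_int \<lfloor>s * x\<rfloor> / s\<bar> \<le> b" for x :: real
        proof -
          have "\<bar>of_int \<lfloor>s * x\<rfloor> - s * x\<bar> \<le> 1" by linarith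
          then have "\<bar>(of_int \<lfloor>s * x\<rfloor> - s * x) / s\<bar> \<le> 1 / s" using elim by (simp add: abs_divide divide_right_mono)
          also have "1 / s \<le> 1" using elim by simp
          finally have "\<bar>of_int \<lfloor>s * x\<rfloor> / s - x\<bar> \<le> 1" using elim by (simp add: diff_divide_distrib)
          then show ?thesis using that by linarith
        qed
        have "\<bar>of_int \<lfloor>s * fst p\<rfloor> / s\<bar> \<le> b" "\<bar>of_int \<lfloor>s * snd p\<rfloor> / s\<bar> \<le> b"
          using order_trans[OF norm_fst_le b[OF True]] order_trans[OF norm_snd_le b[OF True]] by auto
        then have "\<bar>fst p\<bar> \<le> b + 1" "\<bar>snd p\<bar> \<le> b + 1" by (auto intro: close)
        then have "p \<in> ?C" by (cases p) (auto simp: cbox_Pair_eq)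
        then show ?thesis by (simp add: indicator_def)
      qed (simp add: indicator_def)
      then show ?case by simp
    qed
  qed
  moreover have "(\<integral>p. indicator S p \<partial>lborel) = measure lborel S" by simp
  moreover have "eventually (\<lambda>s. (\<integral>p. ?f s p \<partial>lborel)
      = real (card {(m :: int, n :: int). (of_int m / s, of_int n / s) \<in> S}) / s\<^sup>2) at_top"
    using eventually_gt_at_top[of 0] by eventually_elim (rule integral_rounded_indicator[OF bdd])
  ultimately show ?thesis by (simp add: tendsto_cong)
qed

section \<open>The hyperbolic sector and its area\<close>

text \<open>
The linear map sending \<open>(c, d)\<close> to \<open>(c a + d, c b + d)\<close> has determinant \<open>a - b\<close>. It is a shear
in \<open>d\<close> followed by a scaling in \<open>c\<close>, so Fubini and the one-dimensional affine substitution
suffice.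
\<close>
lemma emeasure_linear_forms_vimage:
  fixes a b :: real and R :: "(real \<times> real) set"
  assumes ab: "a \<noteq> b" and R: "R \<in> sets borel"
  shows "emeasure lborel {(c, d). (c * a + d, c * b + d) \<in> R} = emeasure lborel R / ennreal \<bar>a - b\<bar>"
proof -
  let ?h = "\<lambda>(c :: real, d). (c * a + d, c * b + d)"
  have R' [measurable]: "R \<in> sets (borel \<Otimes>\<^sub>M borel)" using R unfolding borel_prod .
  have h [measurable]: "?h \<in> borel \<Otimes>\<^sub>M borel \<rightarrow>\<^sub>M borel \<Otimes>\<^sub>M borel" by measurable
  have sets_eq: "sets (lborel \<Otimes>\<^sub>M lborel) = sets (borel \<Otimes>\<^sub>M (borel :: real measure) :: (real \<times> real) measure)"
    by (intro sets_pair_measure_cong) auto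
  let ?S = "{(c, d). (c * a + d, c * b + d) \<in> R}"
  have S_eq: "?S = ?h -` R \<inter> space (borel \<Otimes>\<^sub>M borel)" by (auto simp: space_pair_measure)
  have S: "?S \<in> sets (borel \<Otimes>\<^sub>M borel)" unfolding S_eq by (rule measurable_sets[OF h R'])
  have ind: "indicator ?S (c, d) = (indicator R (c * a + d, c * b + d) :: ennreal)" for c d
    by (simp add: indicator_def)
  have "emeasure lborel ?S = (\<integral>\<^sup>+p. indicator ?S p \<partial>(lborel \<Otimes>\<^sub>M lborel))"
    using S sets_eq by (simp add: lborel_prod[symmetric])
  also have "\<dots> = (\<integral>\<^sup>+c. \<integral>\<^sup>+d. indicator R (c * a + d, c * b + d) \<partial>lborel \<partial>lborel)"
    using S sets_eq by (subst lborel.nn_integral_fst[symmetric]) (auto simp: ind cong: measurable_cong_sets)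
  also have "\<dots> = (\<integral>\<^sup>+c. \<integral>\<^sup>+x. indicator R (x, x + (b - a) * c) \<partial>lborel \<partial>lborel)"
  proof (rule nn_integral_cong)
    fix c :: real
    have "(\<lambda>x. indicator R (x, x + (b - a) * c)) \<in> borel_measurable borel" by measurable
    from nn_integral_real_affine[OF this, of 1 "c * a"]
    show "(\<integral>\<^sup>+d. indicator R (c * a + d, c * b + d) \<partial>lborel)
        = (\<integral>\<^sup>+x. indicator R (x, x + (b - a) * c) \<partial>lborel)"
      by (simp add: algebra_simps)
  qed
  also have "\<dots> = (\<integral>\<^sup>+x. \<integral>\<^sup>+c. indicator R (x, x + (b - a) * c) \<partial>lborel \<partial>lborel)"
  proof -
    have "(\<lambda>(c, x). indicator R (x, x + (b - a) * c) :: ennreal) \<in> borel_measurable (lborel \<Otimes>\<^sub>M lborel)"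
      by measurable
    from lborel_pair.Fubini'[OF this] show ?thesis by simp
  qed
  also have "\<dots> = (\<integral>\<^sup>+x. (\<integral>\<^sup>+y. indicator R (x, y) \<partial>lborel) / ennreal \<bar>a - b\<bar> \<partial>lborel)"
  proof (rule nn_integral_cong)
    fix x :: real
    have "(\<lambda>y. indicator R (x, y)) \<in> borel_measurable borel" by measurable
    from nn_integral_real_affine[OF this, of "b - a" x]
    have "(\<integral>\<^sup>+y. indicator R (x, y) \<partial>lborel)
       = ennreal \<bar>a - b\<bar> * (\<integral>\<^sup>+c. indicator R (x, x + (b - a) * c) \<partial>lborel)"
      using ab by (simp add: abs_minus_commute)
    then show "(\<integral>\<^sup>+c. indicator R (x, x + (b - a) * c) \<partial>lborel) = (\<integral>\<^sup>+y. indicator R (x, y) \<partial>lborel) / ennreal \<bar>a - b\<bar>"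
      using ab by (simp add: ennreal_mult_divide_eq mult.commute[of "ennreal \<bar>a - b\<bar>"])
  qed
  also have "\<dots> = (\<integral>\<^sup>+x. \<integral>\<^sup>+y. indicator R (x, y) \<partial>lborel \<partial>lborel) / ennreal \<bar>a - b\<bar>"
    by (intro nn_integral_divide) measurable
  also have "(\<integral>\<^sup>+x. \<integral>\<^sup>+y. indicator R (x, y) \<partial>lborel \<partial>lborel) = (\<integral>\<^sup>+p. indicator R p \<partial>(lborel \<Otimes>\<^sub>M lborel))"
    using R' sets_eq by (subst lborel.nn_integral_fst[symmetric]) (auto cong: measurable_cong_sets)
  also have "\<dots> = emeasure lborel R"
    using R by (simp add: lborel_prod)
  finally show ?thesis .
qed

text \<open>
A fundamental domain for the group generated by \<open>(x, y) \<mapsto> (e x, y / e)\<close> and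
\<open>(x, y) \<mapsto> (- x, - y)\<close>: the sign fixes \<open>x > 0\<close>, and the first map multiplies
\<open>\<bar>x / y\<bar>\<close> by \<open>e\<^sup>2\<close>, so that this ratio can be moved into \<open>[1, e\<^sup>2)\<close>.
\<close>
definition sector :: "real \<Rightarrow> (real \<times> real) set" where
  "sector e = {(x, y). 0 < x \<and> \<bar>y\<bar> \<le> x \<and> x < e\<^sup>2 * \<bar>y\<bar>}"

definition hyperbolic_region :: "real \<Rightarrow> (real \<times> real) set" where
  "hyperbolic_region e = sector e \<inter> {(x, y). \<bar>x * y\<bar> \<le> 1}"

lemma hyperbolic_region_borel: "hyperbolic_region e \<in> sets borel"
proof -
  have "hyperbolic_region e = {p. 0 < fst p} \<inter> {p. \<bar>snd p\<bar> \<le> fst p} \<inter> {p. fst p < e\<^sup>2 * \<bar>snd p\<bar>}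
      \<inter> {p. \<bar>fst p * snd p\<bar> \<le> 1}"
    by (auto simp: hyperbolic_region_def sector_def)
  also have "\<dots> \<in> sets borel"
    by (intro sets.Int borel_open borel_closed open_Collect_less closed_Collect_le continuous_intros)
  finally show ?thesis .
qed

lemma hyperbolic_region_le:
  assumes "(x, y) \<in> hyperbolic_region e" "e > 1"
  shows "0 < x" "x < e" "\<bar>y\<bar> < e"
proof -
  have xy: "0 < x" "\<bar>y\<bar> \<le> x" "x < e\<^sup>2 * \<bar>y\<bar>" "\<bar>x\<bar> * \<bar>y\<bar> \<le> 1"
    using assms(1) by (auto simp: hyperbolic_region_def sector_def abs_mult)
  have "x * x < x * (e\<^sup>2 * \<bar>y\<bar>)" using xy by (intro mult_strict_left_mono) auto
  also have "\<dots> = e\<^sup>2 * (\<bar>x\<bar> * \<bar>y\<bar>)" using xy by simp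
  also have "\<dots> \<le> e\<^sup>2 * 1" using xy by (intro mult_left_mono) auto
  finally have "x\<^sup>2 < e\<^sup>2" by (simp add: power2_eq_square)
  then show "x < e" using assms(2) by (auto dest: power_less_imp_less_base)
  then show "0 < x" "\<bar>y\<bar> < e" using xy by auto
qed

text \<open>
Over \<open>x > 0\<close> the fibre is \<open>x / e\<^sup>2 < \<bar>y\<bar> \<le> min x (1 / x)\<close>. It is empty for \<open>x \<ge> e\<close>, and
the minimum is \<open>x\<close> on \<open>[0, 1]\<close> and \<open>1 / x\<close> on \<open>[1, e]\<close>.
\<close>
lemma emeasure_hyperbolic_region:
  assumes e: "e > 1"
  shows "emeasure lborel (hyperbolic_region e) = ennreal (2 * ln e)"
proof -
  let ?R = "hyperbolic_region e"
  have R [measurable]: "?R \<in> sets (borel \<Otimes>\<^sub>M borel)" unfolding borel_prod by (rule hyperbolic_region_borel)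
  have sets_eq: "sets (lborel \<Otimes>\<^sub>M lborel) = sets (borel \<Otimes>\<^sub>M (borel :: real measure) :: (real \<times> real) measure)"
    by (intro sets_pair_measure_cong) auto
  let ?f = "\<lambda>x. (x - x / e\<^sup>2)" and ?g = "\<lambda>x. (1 / x - x / e\<^sup>2)"
  let ?w = "\<lambda>x. (2 * ennreal (?f x)) * indicator {0..1} x + (2 * ennreal (?g x)) * indicator {1..e} x :: ennreal"
  have two: "2 * ennreal z = ennreal (2 * z)" for z by (simp add: ennreal_mult')
  have fibre: "emeasure lborel (Pair x -` ?R) = ?w x" if "x \<noteq> 1" "x \<noteq> 0" for x
  proof (cases "x > 0")
    case False
    then have "Pair x -` ?R = {}" "x \<notin> {0..1}" "x \<notin> {1..e}"
      using that by (auto simp: hyperbolic_region_def sector_def)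
    then show ?thesis by simp
  next
    case x: True
    define m where "m = min x (1 / x)"
    define a where "a = x / e\<^sup>2"
    have a: "a > 0" "a \<le> x" using x e by (auto simp: a_def divide_le_eq one_le_power)
    have "y \<in> Pair x -` ?R \<longleftrightarrow> \<bar>y\<bar> \<le> m \<and> a < \<bar>y\<bar>" for y
    proof -
      have "x < e\<^sup>2 * \<bar>y\<bar> \<longleftrightarrow> a < \<bar>y\<bar>" using e by (simp add: a_def field_simps)
      moreover have "\<bar>x * y\<bar> \<le> 1 \<longleftrightarrow> \<bar>y\<bar> \<le> 1 / x" using x by (simp add: abs_mult field_simps)
      ultimately show ?thesis using x by (auto simp: hyperbolic_region_def sector_def m_def)
    qed
    then have "Pair x -` ?R = {-m..<-a} \<union> {a<..m}" using a by (auto simp: abs_if split: if_splits)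
    moreover have "{-m..<-a} \<inter> {a<..m} = {}" using a by auto
    ultimately have "emeasure lborel (Pair x -` ?R) = emeasure lborel {-m..<-a} + emeasure lborel {a<..m}"
      by (simp add: plus_emeasure)
    \<comment> \<open>The truncation of negative numbers by \<open>ennreal\<close> takes care of empty fibres.\<close>
    also have "\<dots> = 2 * ennreal (m - a)"
    proof (cases "a \<le> m")
      case True
      then show ?thesis by (simp add: mult_2)
    next
      case False
      then show ?thesis by (simp add: ennreal_neg)
    qed
    also have "\<dots> = ?w x"
    proof (cases "x < 1")
      case True
      then have "x \<le> 1 / x" using x by (simp add: field_simps mult_le_one)
      then show ?thesis using x True by (simp add: m_def a_def)
    next
      case False
      then have x1: "x > 1" using that by simp
      then have "1 / x \<le> 1" by simp
      then have "1 / x \<le> x" using x1 by linarith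
      then have m: "m = 1 / x" by (simp add: m_def)
      show ?thesis
      proof (cases "x \<le> e")
        case True
        then show ?thesis using x1 m by (simp add: a_def)
      next
        case False
        then have "e\<^sup>2 \<le> x * x" using e by (simp add: power2_eq_square mult_mono)
        then have "1 / x \<le> x / e\<^sup>2" using x e by (simp add: field_simps)
        then show ?thesis using x1 m False by (simp add: a_def ennreal_neg)
      qed
    qed
    finally show ?thesis .
  qed
  have "emeasure lborel ?R = (\<integral>\<^sup>+x. emeasure lborel (Pair x -` ?R) \<partial>lborel)"
    unfolding lborel_prod[symmetric] using R sets_eq by (intro lborel.emeasure_pair_measure_alt) auto
  also have "\<dots> = (\<integral>\<^sup>+x. ?w x \<partial>lborel)"
  proof (rule nn_integral_cong_AE)
    show "AE x in lborel. emeasure lborel (Pair x -` ?R) = ?w x"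
      using AE_lborel_singleton[of 0] AE_lborel_singleton[of 1] by eventually_elim (rule fibre)
  qed
  also have "\<dots> = (\<integral>\<^sup>+x. ennreal (2 * ?f x) * indicator {0..1} x \<partial>lborel)
      + (\<integral>\<^sup>+x. ennreal (2 * ?g x) * indicator {1..e} x \<partial>lborel)"
    unfolding two by (subst nn_integral_add) auto
  also have "(\<integral>\<^sup>+x. ennreal (2 * ?f x) * indicator {0..1} x \<partial>lborel)
      = (1\<^sup>2 - 1\<^sup>2 / e\<^sup>2) - (0\<^sup>2 - 0\<^sup>2 / e\<^sup>2)"
  proof (rule nn_integral_FTC_Icc[where F = "\<lambda>x. x\<^sup>2 - x\<^sup>2 / e\<^sup>2"])
    show "0 \<le> 2 * ?f x" if "x \<in> {0..1}" for x
      using that e mult_left_mono[of 1 "e\<^sup>2" x] by (simp add: divide_le_eq one_le_power)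
  qed (use e in \<open>auto intro!: derivative_eq_intros simp: field_simps\<close>)
  also have "(\<integral>\<^sup>+x. ennreal (2 * ?g x) * indicator {1..e} x \<partial>lborel)
      = (2 * ln e - e\<^sup>2 / e\<^sup>2) - (2 * ln 1 - 1\<^sup>2 / e\<^sup>2)"
  proof (rule nn_integral_FTC_Icc[where F = "\<lambda>x. 2 * ln x - x\<^sup>2 / e\<^sup>2"])
    fix x assume "x \<in> {1..e}"
    then have x: "1 \<le> x" "x \<le> e" by auto
    have "x * x \<le> e * e" using x by (intro mult_mono) auto
    then show "0 \<le> 2 * ?g x" using x e by (simp add: field_simps power2_eq_square)
    show "((\<lambda>x. 2 * ln x - x\<^sup>2 / e\<^sup>2) has_real_derivative 2 * ?g x) (at x)"
      using x e by (auto intro!: derivative_eq_intros simp: field_simps)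
  qed (use e in auto)
  finally have total: "emeasure lborel ?R
      = ennreal ((1\<^sup>2 - 1\<^sup>2 / e\<^sup>2) - (0\<^sup>2 - 0\<^sup>2 / e\<^sup>2)) + ennreal ((2 * ln e - e\<^sup>2 / e\<^sup>2) - (2 * ln 1 - 1\<^sup>2 / e\<^sup>2))" .
  have "ln (1 / e\<^sup>2) \<le> 1 / e\<^sup>2 - 1" using e by (intro ln_le_minus_one) simp
  then have nn: "0 \<le> (2 * ln e - e\<^sup>2 / e\<^sup>2) - (2 * ln 1 - 1\<^sup>2 / e\<^sup>2)"
    using e by (simp add: ln_div ln_realpow)
  have nn': "0 \<le> (1\<^sup>2 - 1\<^sup>2 / e\<^sup>2) - (0\<^sup>2 - 0\<^sup>2 / e\<^sup>2)"
    using e by (simp add: one_le_power)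
  show ?thesis
    unfolding total ennreal_plus[OF nn' nn, symmetric] using e by simp
qed

lemma frontier_hyperbolic_region:
  "frontier (hyperbolic_region e)
     \<subseteq> {(x, y). x = 0 \<or> \<bar>y\<bar> = x \<or> x = e\<^sup>2 * \<bar>y\<bar> \<or> \<bar>x * y\<bar> = 1}" (is "_ \<subseteq> ?Z")
proof -
  let ?U = "{p. 0 < fst p} \<inter> {p. \<bar>snd p\<bar> < fst p} \<inter> {p. fst p < e\<^sup>2 * \<bar>snd p\<bar>} \<inter> {p :: real \<times> real. \<bar>fst p * snd p\<bar> < 1}"
  let ?V = "{p. fst p < 0} \<union> {p. \<bar>snd p\<bar> > fst p} \<union> {p. fst p > e\<^sup>2 * \<bar>snd p\<bar>} \<union> {p :: real \<times> real. \<bar>fst p * snd p\<bar> > 1}"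
  have U: "open ?U" "open ?V" by (intro open_Int open_Un open_Collect_less continuous_intros)+
  have "?U \<subseteq> interior (hyperbolic_region e)"
    using U(1) by (intro interior_maximal) (auto simp: hyperbolic_region_def sector_def)
  moreover have "closure (hyperbolic_region e) \<subseteq> - ?V"
    by (intro closure_minimal closed_Compl U(2)) (auto simp: hyperbolic_region_def sector_def)
  ultimately show ?thesis by (auto simp: frontier_def subset_iff) (smt (verit))
qed

lemma null_sets_hyperbolic_boundary:
  "{(x, y). x = 0 \<or> \<bar>y\<bar> = x \<or> x = e\<^sup>2 * \<bar>y\<bar> \<or> \<bar>x * y\<bar> = (1::real)} \<in> null_sets lborel" (is "?Z \<in> _")
proof -
  have "?Z = {p. fst p = 0} \<union> {p. \<bar>snd p\<bar> = fst p} \<union> {p. fst p = e\<^sup>2 * \<bar>snd p\<bar>} \<union> {p. \<bar>fst p * snd p\<bar> = 1}"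
    by auto
  also have "\<dots> \<in> sets borel"
    by (intro sets.Un borel_closed closed_Collect_eq continuous_intros)
  finally have Z: "?Z \<in> sets borel" .
  have fibre: "emeasure lborel (Pair x -` ?Z) = 0" if "x \<noteq> 0" for x
  proof -
    have "Pair x -` ?Z \<subseteq> {x, -x, x / e\<^sup>2, - (x / e\<^sup>2), 1 / x, - (1 / x)}"
    proof
      fix y assume "y \<in> Pair x -` ?Z"
      then have "\<bar>y\<bar> = x \<or> x = e\<^sup>2 * \<bar>y\<bar> \<or> \<bar>x * y\<bar> = 1" using that by auto
      then have "\<bar>y\<bar> = x \<or> \<bar>y\<bar> = x / e\<^sup>2 \<or> \<bar>y\<bar> = \<bar>1 / x\<bar>"
      proof (elim disjE)
        assume "x = e\<^sup>2 * \<bar>y\<bar>"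
        moreover from this have "e \<noteq> 0" using that by auto
        ultimately show ?thesis by simp
      next
        assume "\<bar>x * y\<bar> = 1"
        then show ?thesis using that by (simp add: abs_mult field_simps)
      qed simp
      then show "y \<in> {x, -x, x / e\<^sup>2, - (x / e\<^sup>2), 1 / x, - (1 / x)}" by (auto simp: abs_if split: if_splits)
    qed
    then have "finite (Pair x -` ?Z)" by (rule finite_subset) simp
    then show ?thesis by (simp add: finite_imp_null_set_lborel null_setsD1)
  qed
  have sets_eq: "sets (lborel \<Otimes>\<^sub>M lborel) = sets (borel :: (real \<times> real) measure)"
    unfolding lborel_prod by simp
  have "emeasure lborel ?Z = (\<integral>\<^sup>+x. emeasure lborel (Pair x -` ?Z) \<partial>lborel)"
    unfolding lborel_prod[symmetric] using Z sets_eq by (intro lborel.emeasure_pair_measure_alt) auto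
  also have "\<dots> = (\<integral>\<^sup>+(x::real). 0 \<partial>lborel)"
    by (rule nn_integral_cong_AE, use AE_lborel_singleton[of 0] in eventually_elim) (rule fibre)
  finally show ?thesis using Z by auto
qed

section \<open>Conjugate pairs, orbits and units\<close>

text \<open>
Reducing with \<open>z\<^sup>2 = (x + y) z - x y\<close>, which holds at both \<open>x\<close> and \<open>y\<close>, a rational
polynomial takes the values \<open>A + B x\<close> and \<open>A + B y\<close> with common rational \<open>A\<close> and \<open>B\<close>. As
\<open>x\<close> is irrational, vanishing at \<open>x\<close> forces \<open>A = B = 0\<close>. Conversely, the
polynomial \<open>(z - x) (z - y)\<close> excludes every other candidate.
\<close>
lemma galois_conj_eqI:
  assumes x: "x \<notin> \<rat>" and s: "x + y \<in> \<rat>" and m: "x * y \<in> \<rat>"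
  shows "galois_conj x = y"
proof -
  have ne: "y \<noteq> x"
  proof
    assume "y = x"
    then have "(x + y) / 2 = x" by simp
    then show False using x s by (metis Rats_divide Rats_number_of)
  qed
  have lin: "\<exists>A\<in>\<rat>. \<exists>B\<in>\<rat>. poly p x = A + B * x \<and> poly p y = A + B * y"
    if "\<forall>i. coeff p i \<in> \<rat>" for p :: "real poly"
    using that
  proof (induction p)
    case 0
    show ?case by (rule bexI[of _ 0], rule bexI[of _ 0]) auto
  next
    case (pCons a p)
    have a: "a \<in> \<rat>" using pCons.prems[rule_format, of 0] by simp
    have "\<forall>i. coeff p i \<in> \<rat>" using pCons.prems by (metis coeff_pCons_Suc)
    then obtain A B where AB: "A \<in> \<rat>" "B \<in> \<rat>" "poly p x = A + B * x" "poly p y = A + B * y"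
      using pCons.IH by blast
    show ?case
    proof (intro bexI conjI)
      show "poly (pCons a p) x = (a - B * (x * y)) + (A + B * (x + y)) * x"
        "poly (pCons a p) y = (a - B * (x * y)) + (A + B * (x + y)) * y"
        using AB by (simp_all add: algebra_simps)
    qed (use AB a s m in auto)
  qed
  have root: "poly p y = 0" if p: "\<forall>i. coeff p i \<in> \<rat>" "poly p x = 0" for p
  proof -
    obtain A B where AB: "A \<in> \<rat>" "B \<in> \<rat>" "poly p x = A + B * x" "poly p y = A + B * y"
      using lin[OF p(1)] by blast
    have "B = 0"
    proof (rule ccontr)
      assume "B \<noteq> 0"
      then have "x = - A / B" using AB p(2) by (simp add: field_simps)
      then show False using x AB by auto
    qed
    then show ?thesis using AB p(2) by simp
  qed
  have "(THE z. z \<noteq> x \<and> (\<forall>p :: real poly. (\<forall>i. coeff p i \<in> \<rat>) \<longrightarrow> poly p x = 0 \<longrightarrow> poly p z = 0)) = y"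
  proof (rule the_equality)
    show "y \<noteq> x \<and> (\<forall>p :: real poly. (\<forall>i. coeff p i \<in> \<rat>) \<longrightarrow> poly p x = 0 \<longrightarrow> poly p y = 0)"
      using ne root by blast
  next
    fix z assume z: "z \<noteq> x \<and> (\<forall>p :: real poly. (\<forall>i. coeff p i \<in> \<rat>) \<longrightarrow> poly p x = 0 \<longrightarrow> poly p z = 0)"
    let ?p = "[:x * y, - (x + y), 1:] :: real poly"
    have minus: "- x - y \<in> \<rat>" using s Rats_minus_iff[of "x + y"] by simp
    have "\<forall>i. coeff ?p i \<in> \<rat>" using m minus by (auto simp: coeff_pCons split: nat.split)
    moreover have "poly ?p x = 0" by (simp add: algebra_simps)
    ultimately have "poly ?p z = 0" using z by blast
    then have "(z - x) * (z - y) = 0" by (simp add: algebra_simps)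
    then show "z = y" using z by auto
  qed
  then show ?thesis using x by (simp add: galois_conj_def)
qed

text \<open>
For \<open>z = \<alpha>\<close> these are the elements of the order \<open>\<int> + \<alpha> \<int>\<close>; replacing \<open>\<alpha>\<close> by its conjugate
conjugates the element. Numerator and denominator of a homography have this shape as well.
\<close>
definition lin :: "real \<Rightarrow> int \<Rightarrow> int \<Rightarrow> real" where
  "lin z c d = of_int c * z + of_int d"

lemma orbit_singleton:
  "PSL2Z_orbit {z} = {lin z a b / lin z c d | a b c d. a * d - b * c = 1}" (is "_ = ?R")
proof
  show "PSL2Z_orbit {z} \<subseteq> ?R"
    unfolding PSL2Z_orbit_def SL2Z_def homography_def det_2 lin_def by blast
  show "?R \<subseteq> PSL2Z_orbit {z}"
  proof clarify
    fix a b c d :: int assume det: "a * d - b * c = 1"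
    let ?A = "vector [vector [a, b], vector [c, d]] :: int ^ 2 ^ 2"
    have "?A \<in> SL2Z" using det by (simp add: SL2Z_def det_2)
    moreover have "lin z a b / lin z c d = homography ?A z" by (simp add: homography_def lin_def)
    ultimately show "lin z a b / lin z c d \<in> PSL2Z_orbit {z}" unfolding PSL2Z_orbit_def by blast
  qed
qed

lemma coprime_of_det_one:
  fixes a b c d :: int
  assumes "a * d - b * c = 1"
  shows "coprime c d"
proof (rule coprimeI)
  fix r assume "r dvd c" "r dvd d"
  then have "r dvd a * d - b * c" by simp
  then show "is_unit r" using assms by simp
qed

lemma equiv_mod_Z: "equiv UNIV mod_Z"
proof (rule equivI)
  show "sym mod_Z"
  proof (rule symI)
    fix x y assume "(x, y) \<in> mod_Z"
    then have "- (x - y) \<in> \<int>" unfolding mod_Z_def by (intro Ints_minus) auto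
    then show "(y, x) \<in> mod_Z" by (simp add: mod_Z_def)
  qed
  show "trans mod_Z"
  proof (rule transI)
    fix x y z assume "(x, y) \<in> mod_Z" "(y, z) \<in> mod_Z"
    then have "(x - y) + (y - z) \<in> \<int>" unfolding mod_Z_def by (intro Ints_add) auto
    then show "(x, z) \<in> mod_Z" by (simp add: mod_Z_def)
  qed
qed (auto simp: mod_Z_def refl_on_def)

lemma mod_Z_class_eq_iff: "mod_Z `` {x} = mod_Z `` {y} \<longleftrightarrow> x - y \<in> \<int>"
  using eq_equiv_class_iff[OF equiv_mod_Z, of x y] by (simp add: mod_Z_def)

text \<open>
The assumptions are symmetric up to irrationality, so that every result holds for both
orderings of the pair. Elements of the order are handled through their integer coordinates, which
makes conjugation the passage from \<open>lin \<alpha> p q\<close> to \<open>lin \<beta> p q\<close>.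
\<close>
locale conjugate_pair =
  fixes \<alpha> \<beta> :: real and tr nm :: int
  assumes irrational: "\<alpha> \<notin> \<rat>"
    and trace: "\<alpha> + \<beta> = of_int tr"
    and norm: "\<alpha> * \<beta> = of_int nm"
begin

lemma distinct: "\<alpha> \<noteq> \<beta>"
proof
  assume "\<alpha> = \<beta>"
  then have eq: "of_int tr / 2 = \<alpha>" using trace by simp
  have "of_int tr / 2 \<in> (\<rat> :: real set)" by simp
  then show False using irrational unfolding eq by contradiction
qed

lemma irrational': "\<beta> \<notin> \<rat>"
proof
  assume "\<beta> \<in> \<rat>"
  then have "of_int tr - \<beta> \<in> \<rat>" by simp
  moreover have "of_int tr - \<beta> = \<alpha>" using trace by linarith
  ultimately show False using irrational by simp
qed

lemma swap: "conjugate_pair \<beta> \<alpha> tr nm"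
  using irrational' trace norm by unfold_locales (simp_all add: algebra_simps)

lemma galois_conj_alpha: "galois_conj \<alpha> = \<beta>"
  using irrational trace norm by (intro galois_conj_eqI) auto

lemma lin_eq_iff: "lin \<alpha> c d = lin \<alpha> c' d' \<longleftrightarrow> c = c' \<and> d = d'"
proof
  assume eq: "lin \<alpha> c d = lin \<alpha> c' d'"
  have "c = c'"
  proof (rule ccontr)
    assume "c \<noteq> c'"
    moreover have "(of_int c - of_int c') * \<alpha> = of_int d' - of_int d"
      using eq by (simp add: lin_def left_diff_distrib)
    ultimately have "\<alpha> = (of_int d' - of_int d) / (of_int c - of_int c')"
      by (simp add: eq_divide_eq mult.commute)
    then show False using irrational by simp
  qed
  then show "c = c' \<and> d = d'" using eq by (simp add: lin_def)
qed simp

lemma lin_eq_0_iff: "lin \<alpha> c d = 0 \<longleftrightarrow> c = 0 \<and> d = 0"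
  using lin_eq_iff[of c d 0 0] by (simp add: lin_def)

lemma lin_mult: "lin \<alpha> c d * lin \<alpha> p q = lin \<alpha> (c * q + d * p + c * p * tr) (d * q - c * p * nm)"
proof -
  have "\<alpha> * \<alpha> = (\<alpha> + \<beta>) * \<alpha> - \<alpha> * \<beta>" by (simp add: algebra_simps)
  then have sq: "\<alpha> * \<alpha> = of_int tr * \<alpha> - of_int nm" using trace norm by simp
  have "lin \<alpha> c d * lin \<alpha> p q = of_int c * of_int p * (\<alpha> * \<alpha>) + (of_int c * of_int q + of_int d * of_int p) * \<alpha> + of_int d * of_int q"
    by (simp add: lin_def algebra_simps)
  also have "\<dots> = lin \<alpha> (c * q + d * p + c * p * tr) (d * q - c * p * nm)"
    unfolding sq by (simp add: lin_def algebra_simps)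
  finally show ?thesis .
qed

lemmas lin_mult' = conjugate_pair.lin_mult[OF swap]
lemmas lin_eq_0_iff' = conjugate_pair.lin_eq_0_iff[OF swap]

lemma lin_conj: "lin \<beta> c d = lin \<alpha> (- c) (d + c * tr)" "lin \<alpha> c d = lin \<beta> (- c) (d + c * tr)"
proof -
  have "of_int c * \<alpha> + of_int c * \<beta> = (of_int (c * tr) :: real)"
    using trace by (simp flip: distrib_left)
  then show "lin \<beta> c d = lin \<alpha> (- c) (d + c * tr)" "lin \<alpha> c d = lin \<beta> (- c) (d + c * tr)"
    by (simp_all add: lin_def)
qed

lemma lin_norm_int: "lin \<alpha> c d * lin \<beta> c d \<in> \<int>"
proof -
  have "lin \<alpha> c d * lin \<beta> c d = of_int c * of_int c * (\<alpha> * \<beta>) + of_int c * of_int d * (\<alpha> + \<beta>) + of_int d * of_int d"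
    by (simp add: lin_def algebra_simps)
  then show ?thesis unfolding trace norm by simp
qed

text \<open>
This determinant identity turns the determinant of an integer matrix into a statement about its
image vectors and their conjugates. It computes \<open>w - galois_conj w\<close> for \<open>w\<close> in an orbit, and it
shows that multiplying both rows by one element of the order multiplies the determinant by the norm.
\<close>
lemma lin_wronskian:
  "lin \<alpha> a b * lin \<beta> c d - lin \<beta> a b * lin \<alpha> c d = of_int (a * d - b * c) * (\<alpha> - \<beta>)"
  by (simp add: lin_def algebra_simps)

lemma galois_conj_homography:
  assumes det: "a * d - b * c = 1"
  shows "galois_conj (lin \<alpha> a b / lin \<alpha> c d) = lin \<beta> a b / lin \<beta> c d"
proof (rule galois_conj_eqI)
  have nz: "lin \<alpha> c d \<noteq> 0" "lin \<beta> c d \<noteq> 0" using det by (auto simp: lin_eq_0_iff lin_eq_0_iff')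
  show "lin \<alpha> a b / lin \<alpha> c d \<notin> \<rat>"
  proof
    assume "lin \<alpha> a b / lin \<alpha> c d \<in> \<rat>"
    then obtain w where w: "w \<in> \<rat>" "lin \<alpha> a b / lin \<alpha> c d = w" by blast
    have "lin \<alpha> a b = w * lin \<alpha> c d" using nz w(2) by (simp add: divide_eq_eq)
    then have eq: "(of_int a - w * of_int c) * \<alpha> = w * of_int d - of_int b"
      by (simp add: lin_def algebra_simps)
    have "of_int a - w * of_int c = 0"
    proof (rule ccontr)
      assume "of_int a - w * of_int c \<noteq> 0"
      then have "\<alpha> = (w * of_int d - of_int b) / (of_int a - w * of_int c)"
        using eq by (simp add: eq_divide_eq mult.commute)
      moreover have "(w * of_int d - of_int b) / (of_int a - w * of_int c) \<in> \<rat>"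
        using w(1) by (intro Rats_divide Rats_diff Rats_mult) auto
      ultimately show False using irrational by simp
    qed
    with eq have ab: "of_int a = w * of_int c" "of_int b = w * of_int d" by auto
    have "of_int (a * d - b * c) = of_int a * of_int d - of_int b * (of_int c :: real)" by simp
    also have "\<dots> = 0" unfolding ab by simp
    finally show False using det by simp
  qed
  have num: "lin \<alpha> a b * lin \<beta> c d + lin \<beta> a b * lin \<alpha> c d \<in> \<int>"
  proof -
    have "lin \<alpha> a b * lin \<beta> c d + lin \<beta> a b * lin \<alpha> c d
      = 2 * of_int a * of_int c * (\<alpha> * \<beta>) + (of_int a * of_int d + of_int b * of_int c) * (\<alpha> + \<beta>) + 2 * of_int b * of_int d"
      by (simp add: lin_def algebra_simps)
    then show ?thesis unfolding trace norm by simp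
  qed
  have Rats: "z \<in> \<int> \<Longrightarrow> z \<in> \<rat>" for z :: real using Ints_subset_Rats by blast
  have "lin \<alpha> a b / lin \<alpha> c d + lin \<beta> a b / lin \<beta> c d
      = (lin \<alpha> a b * lin \<beta> c d + lin \<beta> a b * lin \<alpha> c d) / (lin \<alpha> c d * lin \<beta> c d)"
    using nz by (simp add: field_simps)
  then show "lin \<alpha> a b / lin \<alpha> c d + lin \<beta> a b / lin \<beta> c d \<in> \<rat>"
    using Rats[OF num] Rats[OF lin_norm_int] by simp
  have "lin \<alpha> a b / lin \<alpha> c d * (lin \<beta> a b / lin \<beta> c d)
      = (lin \<alpha> a b * lin \<beta> a b) / (lin \<alpha> c d * lin \<beta> c d)" by simp
  then show "lin \<alpha> a b / lin \<alpha> c d * (lin \<beta> a b / lin \<beta> c d) \<in> \<rat>"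
    using Rats[OF lin_norm_int] by simp
qed

lemma galois_conj_lin: "galois_conj (lin \<alpha> p q) = lin \<beta> p q"
proof (cases "p = 0")
  case True
  then show ?thesis by (simp add: galois_conj_def lin_def)
next
  case False
  have Rats: "z \<in> \<int> \<Longrightarrow> z \<in> \<rat>" for z :: real using Ints_subset_Rats by blast
  show ?thesis
  proof (rule galois_conj_eqI)
    show "lin \<alpha> p q \<notin> \<rat>"
    proof
      assume "lin \<alpha> p q \<in> \<rat>"
      then have "(lin \<alpha> p q - of_int q) / of_int p \<in> \<rat>" by (intro Rats_divide Rats_diff) auto
      then show False using irrational False by (simp add: lin_def)
    qed
    have "lin \<alpha> p q + lin \<beta> p q = of_int p * (\<alpha> + \<beta>) + 2 * of_int q" by (simp add: lin_def algebra_simps)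
    then show "lin \<alpha> p q + lin \<beta> p q \<in> \<rat>" unfolding trace by simp
    show "lin \<alpha> p q * lin \<beta> p q \<in> \<rat>" by (rule Rats[OF lin_norm_int])
  qed
qed

lemma inverse_conj_distance:
  assumes det: "a * d - b * c = 1" and w: "w = lin \<alpha> a b / lin \<alpha> c d"
  shows "inverse \<bar>w - galois_conj w\<bar> = \<bar>lin \<alpha> c d * lin \<beta> c d\<bar> / \<bar>\<alpha> - \<beta>\<bar>"
proof -
  have nz: "lin \<alpha> c d \<noteq> 0" "lin \<beta> c d \<noteq> 0" using det by (auto simp: lin_eq_0_iff lin_eq_0_iff')
  have "w - galois_conj w = (lin \<alpha> a b * lin \<beta> c d - lin \<beta> a b * lin \<alpha> c d) / (lin \<alpha> c d * lin \<beta> c d)"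
    unfolding w galois_conj_homography[OF det] using nz by (simp add: field_simps)
  also have "\<dots> = (\<alpha> - \<beta>) / (lin \<alpha> c d * lin \<beta> c d)" unfolding lin_wronskian det by simp
  finally show ?thesis by (simp add: inverse_eq_divide abs_divide)
qed

text \<open>
The assumption says that matrices \<open>g\<close> and \<open>g'\<close> of determinants \<open>e\<close> and \<open>e'\<close> send \<open>\<alpha>\<close> to the
same point. Then \<open>h = inverse g' * g\<close> is an integer matrix fixing \<open>\<alpha>\<close>, so \<open>(\<alpha>, 1)\<close> is an
eigenvector of \<open>h\<close>. The eigenvalue is \<open>lin \<alpha> p q\<close>, where \<open>(p, q)\<close> is the bottom row
of \<open>h\<close>, and its norm is the determinant of \<open>h\<close>.
\<close>
lemma ratio_is_unit:
  assumes det: "a * d - b * c = e" "a' * d' - b' * c' = e'"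
    and e: "\<bar>e\<bar> = 1" "\<bar>e'\<bar> = 1"
    and eq: "lin \<alpha> a b * lin \<alpha> c' d' = lin \<alpha> a' b' * lin \<alpha> c d"
  obtains p q where "lin \<alpha> c d = lin \<alpha> c' d' * lin \<alpha> p q" "lin \<beta> c d = lin \<beta> c' d' * lin \<beta> p q"
    "lin \<alpha> p q * lin \<beta> p q = of_int (e * e')"
proof -
  have transfer: "lin \<beta> x y = lin \<beta> x' y' * lin \<beta> u v" if "lin \<alpha> x y = lin \<alpha> x' y' * lin \<alpha> u v" for x y x' y' u v
    using that unfolding lin_mult lin_mult' lin_eq_iff by simp
  \<comment> \<open>The bottom row of \<open>inverse g' * g\<close>; dividing by the determinant of \<open>g'\<close> is multiplying by \<open>e'\<close>.\<close>
  define p where "p = e' * (a' * c - c' * a)"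
  define q where "q = e' * (a' * d - c' * b)"
  have e'2: "e' * e' = 1" using e(2) by (auto simp: abs_if split: if_splits)
  have nz: "lin \<alpha> c' d' \<noteq> 0" using det e by (auto simp: lin_eq_0_iff)
  have pq: "lin \<alpha> p q = of_int e' * (of_int a' * lin \<alpha> c d - of_int c' * lin \<alpha> a b)"
    by (simp add: p_def q_def lin_def algebra_simps)
  have "lin \<alpha> c' d' * lin \<alpha> p q
      = of_int e' * (of_int a' * lin \<alpha> c' d' * lin \<alpha> c d - of_int c' * (lin \<alpha> a b * lin \<alpha> c' d'))"
    unfolding pq by (simp add: algebra_simps)
  also have "\<dots> = of_int e' * (of_int a' * lin \<alpha> c' d' - of_int c' * lin \<alpha> a' b') * lin \<alpha> c d"
    unfolding eq by (simp add: algebra_simps)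
  also have "of_int a' * lin \<alpha> c' d' - of_int c' * lin \<alpha> a' b' = of_int (a' * d' - b' * c')"
    by (simp add: lin_def algebra_simps)
  also have "of_int e' * of_int (a' * d' - b' * c') = (1 :: real)"
    unfolding det using e'2 by (simp flip: of_int_mult)
  finally have C: "lin \<alpha> c d = lin \<alpha> c' d' * lin \<alpha> p q" by simp
  have "lin \<alpha> c' d' * lin \<alpha> a b = lin \<alpha> c' d' * (lin \<alpha> a' b' * lin \<alpha> p q)"
    using eq unfolding C by (simp add: algebra_simps)
  then have A: "lin \<alpha> a b = lin \<alpha> a' b' * lin \<alpha> p q" using nz by simp
  have "of_int e * (\<alpha> - \<beta>) = lin \<alpha> a b * lin \<beta> c d - lin \<beta> a b * lin \<alpha> c d"
    unfolding lin_wronskian det ..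
  also have "\<dots> = (lin \<alpha> p q * lin \<beta> p q) * (lin \<alpha> a' b' * lin \<beta> c' d' - lin \<beta> a' b' * lin \<alpha> c' d')"
    unfolding A C transfer[OF A] transfer[OF C] by (simp add: algebra_simps)
  also have "\<dots> = (lin \<alpha> p q * lin \<beta> p q) * of_int e' * (\<alpha> - \<beta>)"
    unfolding lin_wronskian det by simp
  finally have "of_int e = lin \<alpha> p q * lin \<beta> p q * of_int e'" using distinct by simp
  then have "of_int e * of_int e' = lin \<alpha> p q * lin \<beta> p q * (of_int (e' * e'))" by simp
  then have "lin \<alpha> p q * lin \<beta> p q = of_int (e * e')" using e'2 by simp
  with C transfer[OF C] show thesis by (rule that)
qed

lemma multiply_by_unit:
  obtains a' b' c' d' where
    "lin \<alpha> a' b' = lin \<alpha> a b * lin \<alpha> p q" "lin \<alpha> c' d' = lin \<alpha> c d * lin \<alpha> p q"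
    "lin \<beta> a' b' = lin \<beta> a b * lin \<beta> p q" "lin \<beta> c' d' = lin \<beta> c d * lin \<beta> p q"
    "of_int (a' * d' - b' * c') = of_int (a * d - b * c) * (lin \<alpha> p q * lin \<beta> p q)"
proof -
  define a' where "a' = a * q + b * p + a * p * tr"
  define b' where "b' = b * q - a * p * nm"
  define c' where "c' = c * q + d * p + c * p * tr"
  define d' where "d' = d * q - c * p * nm"
  have *: "lin \<alpha> a' b' = lin \<alpha> a b * lin \<alpha> p q" "lin \<alpha> c' d' = lin \<alpha> c d * lin \<alpha> p q"
    "lin \<beta> a' b' = lin \<beta> a b * lin \<beta> p q" "lin \<beta> c' d' = lin \<beta> c d * lin \<beta> p q"
    unfolding lin_mult lin_mult' a'_def b'_def c'_def d'_def by (rule refl)+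
  have "of_int (a' * d' - b' * c') * (\<alpha> - \<beta>) = (lin \<alpha> p q * lin \<beta> p q) * (lin \<alpha> a b * lin \<beta> c d - lin \<beta> a b * lin \<alpha> c d)"
    unfolding lin_wronskian[symmetric] * by (simp add: algebra_simps)
  also have "\<dots> = of_int (a * d - b * c) * (lin \<alpha> p q * lin \<beta> p q) * (\<alpha> - \<beta>)"
    unfolding lin_wronskian by simp
  finally have "of_int (a' * d' - b' * c') = of_int (a * d - b * c) * (lin \<alpha> p q * lin \<beta> p q)"
    using distinct by simp
  with * show thesis by (rule that)
qed

end

section \<open>Counting the classes in one orbit\<close>

text \<open>
The gap between \<open>1 / e\<close> and \<open>e\<close> expresses that \<open>e\<close> and \<open>- 1\<close> generate the units of
norm \<open>1\<close>, in the form in which the uniqueness of sector representatives uses it.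
\<close>
locale norm_one_generator = conjugate_pair +
  fixes e :: real and p0 q0 :: int
  assumes e_gt_1: "e > 1"
    and generator: "lin \<alpha> p0 q0 = e" "lin \<beta> p0 q0 = 1 / e"
    and minimal: "\<And>p q. lin \<alpha> p q * lin \<beta> p q = 1 \<Longrightarrow> 1 / e < lin \<alpha> p q \<Longrightarrow> lin \<alpha> p q < e \<Longrightarrow> lin \<alpha> p q = 1"
begin

definition points :: "real \<Rightarrow> (int \<times> int) set" where
  "points T = {(c, d). (lin \<alpha> c d, lin \<beta> c d) \<in> sector e \<and> \<bar>lin \<alpha> c d * lin \<beta> c d\<bar> \<le> T}"

definition primitive_points :: "real \<Rightarrow> (int \<times> int) set" where
  "primitive_points T = points T \<inter> {(c, d). coprime c d}"

definition region :: "(real \<times> real) set" where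
  "region = {(c, d). (c * \<alpha> + d, c * \<beta> + d) \<in> hyperbolic_region e}"

lemma bounded_region: "bounded region"
proof -
  let ?r = "2 * e / \<bar>\<alpha> - \<beta>\<bar>"
  have "region \<subseteq> cbox (- ?r, - (e + ?r * \<bar>\<alpha>\<bar>)) (?r, e + ?r * \<bar>\<alpha>\<bar>)"
  proof (rule subsetI)
    fix p assume "p \<in> region"
    then obtain c d where p: "p = (c, d)" and h: "(c * \<alpha> + d, c * \<beta> + d) \<in> hyperbolic_region e" by (auto simp: region_def)
    note le = hyperbolic_region_le[OF h e_gt_1]
    have "\<bar>c\<bar> * \<bar>\<alpha> - \<beta>\<bar> = \<bar>(c * \<alpha> + d) - (c * \<beta> + d)\<bar>"
      by (simp add: abs_mult[symmetric] algebra_simps)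
    also have "\<dots> \<le> 2 * e" using le by linarith
    finally have c: "\<bar>c\<bar> \<le> ?r" using distinct by (simp add: pos_le_divide_eq)
    have "\<bar>c * \<alpha>\<bar> \<le> ?r * \<bar>\<alpha>\<bar>" using c by (simp only: abs_mult) (rule mult_right_mono, auto)
    then have "\<bar>d\<bar> \<le> e + ?r * \<bar>\<alpha>\<bar>" using le by linarith
    then show "p \<in> cbox (- ?r, - (e + ?r * \<bar>\<alpha>\<bar>)) (?r, e + ?r * \<bar>\<alpha>\<bar>)"
      using c unfolding p cbox_Pair_eq mem_Times_iff fst_conv snd_conv box_real atLeastAtMost_iff by linarith
  qed
  then show ?thesis using bounded_cbox bounded_subset by blast
qed

lemma region_vimage: "region = (\<lambda>p. (fst p * \<alpha> + snd p, fst p * \<beta> + snd p)) -` hyperbolic_region e"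
  by (auto simp: region_def)

lemma continuous_forms:
  "continuous_on UNIV (\<lambda>p :: real \<times> real. (fst p * \<alpha> + snd p, fst p * \<beta> + snd p))"
  by (intro continuous_intros)

lemma region_borel: "region \<in> sets borel"
  using measurable_sets[OF borel_measurable_continuous_onI[OF continuous_forms] hyperbolic_region_borel]
  by (simp add: region_vimage)

lemma frontier_region: "frontier region \<in> null_sets lborel"
proof -
  let ?h = "\<lambda>p :: real \<times> real. (fst p * \<alpha> + snd p, fst p * \<beta> + snd p)"
  let ?Z = "{(x, y). x = 0 \<or> \<bar>y\<bar> = x \<or> x = e\<^sup>2 * \<bar>y\<bar> \<or> \<bar>x * y\<bar> = (1::real)}"
  have Z: "?Z \<in> null_sets lborel" by (rule null_sets_hyperbolic_boundary)
  then have Zb: "?Z \<in> sets borel" by (auto dest: null_setsD2)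
  have eq: "?h -` ?Z = {(c, d). (c * \<alpha> + d, c * \<beta> + d) \<in> ?Z}" by auto
  have "emeasure lborel (?h -` ?Z) = 0"
    unfolding eq emeasure_linear_forms_vimage[OF distinct Zb] using Z by (simp add: null_setsD1)
  moreover have "?h -` ?Z \<in> sets borel"
    using measurable_sets[OF borel_measurable_continuous_onI[OF continuous_forms] Zb] by simp
  ultimately have null: "?h -` ?Z \<in> null_sets lborel" by auto
  have "frontier region \<subseteq> ?h -` frontier (hyperbolic_region e)"
  proof -
    have "closure region \<subseteq> ?h -` closure (hyperbolic_region e)"
      unfolding region_vimage
      by (intro closure_minimal vimage_mono closure_subset continuous_closed_vimage closed_closure)
        (use continuous_forms in \<open>auto simp: continuous_on_eq_continuous_at\<close>)
    moreover have "?h -` interior (hyperbolic_region e) \<subseteq> interior region"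
      unfolding region_vimage
      by (intro interior_maximal vimage_mono interior_subset open_vimage continuous_forms open_interior)
    ultimately show ?thesis by (auto simp: frontier_def)
  qed
  also have "\<dots> \<subseteq> ?h -` ?Z" using frontier_hyperbolic_region by (intro vimage_mono)
  finally have "frontier region \<subseteq> ?h -` ?Z" .
  then show ?thesis by (rule null_sets_subset[OF null, rotated]) simp
qed

lemma measure_region: "measure lborel region = 2 * ln e / \<bar>\<alpha> - \<beta>\<bar>"
  unfolding region_def measure_def
    emeasure_linear_forms_vimage[OF distinct hyperbolic_region_borel] emeasure_hyperbolic_region[OF e_gt_1]
  using distinct e_gt_1 by (simp add: divide_ennreal)

text \<open>
The sector is a cone and the norm is homogeneous of degree \<open>2\<close>, so the points of norm at most
\<open>s\<^sup>2\<close> are the lattice points of the region dilated by \<open>s\<close>.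
\<close>
lemma points_scaled:
  assumes s: "s > 0"
  shows "{(m :: int, n :: int). (of_int m / s, of_int n / s) \<in> region} = points (s\<^sup>2)"
proof -
  have sc: "of_int m / s * z + of_int n / s = lin z m n / s" for m n z
    by (simp add: lin_def add_divide_distrib)
  have eqv: "(x / s, y / s) \<in> hyperbolic_region e \<longleftrightarrow> (x, y) \<in> sector e \<and> \<bar>x * y\<bar> \<le> s\<^sup>2" for x y
  proof -
    have "\<bar>x / s * (y / s)\<bar> = \<bar>x * y\<bar> / s\<^sup>2" using s by (simp add: abs_mult power2_eq_square)
    then have "\<bar>x / s * (y / s)\<bar> \<le> 1 \<longleftrightarrow> \<bar>x * y\<bar> \<le> s\<^sup>2" using s by (simp only: pos_divide_le_eq zero_less_power mult_1)
    moreover have "x / s < e\<^sup>2 * \<bar>y / s\<bar> \<longleftrightarrow> x < e\<^sup>2 * \<bar>y\<bar>" "\<bar>y / s\<bar> \<le> x / s \<longleftrightarrow> \<bar>y\<bar> \<le> x"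
      "0 < x / s \<longleftrightarrow> 0 < x"
      using s by (simp_all add: field_simps)
    ultimately show ?thesis
      by (simp only: hyperbolic_region_def sector_def Int_iff mem_Collect_eq prod.case)
  qed
  have "(of_int m / s, of_int n / s) \<in> region \<longleftrightarrow> (m, n) \<in> points (s\<^sup>2)" for m n
    by (simp only: region_def points_def mem_Collect_eq prod.case sc eqv)
  then show ?thesis by auto
qed

lemma finite_points: "finite (points T)"
proof -
  have "finite (points ((sqrt (max T 1))\<^sup>2))"
    using finite_lattice_points_scaled[OF bounded_region, of "sqrt (max T 1)"] points_scaled[of "sqrt (max T 1)"]
    by simp
  then show ?thesis by (rule rev_finite_subset) (auto simp: points_def)
qed

lemma points_asymptotics: "((\<lambda>T. real (card (points T)) / T) \<longlongrightarrow> 2 * ln e / \<bar>\<alpha> - \<beta>\<bar>) at_top"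
proof -
  have "((\<lambda>s. real (card {(m :: int, n :: int). (of_int m / s, of_int n / s) \<in> region}) / s\<^sup>2)
      \<longlongrightarrow> 2 * ln e / \<bar>\<alpha> - \<beta>\<bar>) at_top"
    using lattice_points_scaled_region[OF bounded_region region_borel frontier_region] by (simp add: measure_region)
  from filterlim_compose[OF this sqrt_at_top]
  show ?thesis
  proof (rule Lim_transform_eventually)
    show "eventually (\<lambda>T. real (card {(m :: int, n :: int). (of_int m / sqrt T, of_int n / sqrt T) \<in> region}) / (sqrt T)\<^sup>2
        = real (card (points T)) / T) at_top"
      using eventually_gt_at_top[of 0] by eventually_elim (simp add: points_scaled)
  qed
qed

lemma primitive_points_small:
  assumes "T < 1"
  shows "primitive_points T = {}"
proof -
  have False if "(c, d) \<in> primitive_points T" for c d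
  proof -
    have cd: "(lin \<alpha> c d, lin \<beta> c d) \<in> sector e" "\<bar>lin \<alpha> c d * lin \<beta> c d\<bar> < 1"
      using that assms by (auto simp: primitive_points_def points_def)
    obtain n :: int where n: "lin \<alpha> c d * lin \<beta> c d = of_int n" using lin_norm_int Ints_cases by blast
    then have "n = 0" using cd(2) by simp
    then show False using n cd(1) by (auto simp: sector_def)
  qed
  then show ?thesis by auto
qed

text \<open>
Dividing a vector by its greatest common divisor \<open>k + 1\<close> preserves the sector and divides the norm
by \<open>(k + 1)\<^sup>2\<close>. Only finitely many terms are nonzero, because a nonzero norm is at
least \<open>1\<close> in absolute value.
\<close>
lemma points_by_gcd:
  assumes T: "T > 0"
  shows "(\<lambda>k. real (card (primitive_points (T / (real k + 1)\<^sup>2)))) sums real (card (points T))"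
proof -
  define n where "n = nat \<lceil>T\<rceil>"
  let ?P = "\<lambda>k :: nat. primitive_points (T / (real k + 1)\<^sup>2)"
  have lin_scale: "lin z (g * c) (g * d) = of_int g * lin z c d" for z g c d
    by (simp add: lin_def algebra_simps)
  have pts_scale: "(int (Suc k) * c, int (Suc k) * d) \<in> points T \<longleftrightarrow> (c, d) \<in> points (T / (real k + 1)\<^sup>2)" for k c d
  proof -
    let ?g = "real k + 1"
    have g: "?g > 0" by simp
    have "(?g * x, ?g * y) \<in> sector e \<longleftrightarrow> (x, y) \<in> sector e" for x y
      using g by (simp add: sector_def abs_mult zero_less_mult_iff mult.left_commute[of _ ?g] del: mult_le_0_iff)
    moreover have "\<bar>?g * x * (?g * y)\<bar> \<le> T \<longleftrightarrow> \<bar>x * y\<bar> \<le> T / ?g\<^sup>2" for x y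
    proof -
      have "\<bar>?g * x * (?g * y)\<bar> = \<bar>x * y\<bar> * ?g\<^sup>2" using g by (simp add: abs_mult power2_eq_square)
      then show ?thesis using g by (simp add: pos_le_divide_eq)
    qed
    ultimately show ?thesis by (simp add: points_def lin_scale add.commute)
  qed
  have zero: "?P k = {}" if "k \<ge> n" for k
  proof (rule primitive_points_small)
    have "T \<le> real k" using that by (simp add: n_def nat_le_iff ceiling_le_iff)
    also have "\<dots> < (real k + 1)\<^sup>2" by (simp add: power2_eq_square algebra_simps add_pos_nonneg)
    finally show "T / (real k + 1)\<^sup>2 < 1" by simp
  qed
  have "bij_betw (\<lambda>(k, c, d). (int (Suc k) * c, int (Suc k) * d)) (SIGMA k:{..<n}. ?P k) (points T)"
  proof (rule bij_betwI')
    fix x y assume x: "x \<in> (SIGMA k:{..<n}. ?P k)" and y: "y \<in> (SIGMA k:{..<n}. ?P k)"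
    obtain k c d k' c' d' where xy: "x = (k, c, d)" "y = (k', c', d')" by (metis prod_cases3)
    have co: "coprime c d" "coprime c' d'" using x y xy by (auto simp: primitive_points_def)
    have "k = k' \<and> c = c' \<and> d = d'"
      if eq: "int (Suc k) * c = int (Suc k') * c'" "int (Suc k) * d = int (Suc k') * d'"
    proof -
      have "gcd (int (Suc k) * c) (int (Suc k) * d) = int (Suc k)"
        using co(1) by (simp add: gcd_mult_distrib_int[symmetric] del: of_nat_Suc)
      moreover have "gcd (int (Suc k') * c') (int (Suc k') * d') = int (Suc k')"
        using co(2) by (simp add: gcd_mult_distrib_int[symmetric] del: of_nat_Suc)
      ultimately have "int (Suc k) = int (Suc k')" unfolding eq by simp
      then show ?thesis using eq by simp
    qed
    then show "(case x of (k, c, d) \<Rightarrow> (int (Suc k) * c, int (Suc k) * d))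
        = (case y of (k, c, d) \<Rightarrow> (int (Suc k) * c, int (Suc k) * d)) \<longleftrightarrow> x = y"
      unfolding xy by (auto simp del: of_nat_Suc)
  next
    fix x assume "x \<in> (SIGMA k:{..<n}. ?P k)"
    then show "(case x of (k, c, d) \<Rightarrow> (int (Suc k) * c, int (Suc k) * d)) \<in> points T"
      by (auto simp: primitive_points_def pts_scale simp del: of_nat_Suc)
  next
    fix v assume v: "v \<in> points T"
    obtain c d where cd: "v = (c, d)" by (cases v)
    have "lin \<alpha> c d > 0" using v by (simp add: cd points_def sector_def)
    then have "c \<noteq> 0 \<or> d \<noteq> 0" by (auto simp: lin_def)
    then obtain c' d' where g: "c = gcd c d * c'" "d = gcd c d * d'" "coprime c' d'"
      using gcd_coprime_exists[of c d] by (auto simp: mult.commute)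
    define k where "k = nat (gcd c d) - 1"
    have "gcd c d > 0" using \<open>c \<noteq> 0 \<or> d \<noteq> 0\<close> by (simp add: gcd_pos_int)
    then have k: "int (Suc k) = gcd c d" by (simp add: k_def)
    have v_eq: "v = (int (Suc k) * c', int (Suc k) * d')" using cd g k by simp
    have mem: "(c', d') \<in> ?P k"
      using v g(3) unfolding v_eq pts_scale by (simp add: primitive_points_def)
    then have "k < n" using zero[of k] by (cases "k < n") auto
    then show "\<exists>x\<in>(SIGMA k:{..<n}. ?P k). v = (case x of (k, c, d) \<Rightarrow> (int (Suc k) * c, int (Suc k) * d))"
      using mem v_eq by (intro bexI[of _ "(k, c', d')"]) auto
  qed
  then have "card (points T) = card (SIGMA k:{..<n}. ?P k)" by (simp add: bij_betw_same_card)
  also have "\<dots> = (\<Sum>k<n. card (?P k))"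
    using finite_points by (intro card_SigmaI) (auto simp: primitive_points_def)
  finally have "real (card (points T)) = (\<Sum>k<n. real (card (?P k)))" by simp
  then show ?thesis
    using sums_finite[of "{..<n}" "\<lambda>k. real (card (?P k))"] zero by simp
qed

lemma primitive_points_asymptotics:
  "((\<lambda>T. real (card (primitive_points T)) / T) \<longlongrightarrow> 12 * ln e / (pi\<^sup>2 * \<bar>\<alpha> - \<beta>\<bar>)) at_top"
proof -
  have "mono (\<lambda>T. real (card (primitive_points T)))"
    using finite_points by (intro monoI of_nat_mono card_mono) (auto simp: primitive_points_def points_def)
  from tendsto_primitive_count[OF points_by_gcd _ _ this points_asymptotics]
  have "((\<lambda>T. real (card (primitive_points T)) / T) \<longlongrightarrow> 6 / pi\<^sup>2 * (2 * ln e / \<bar>\<alpha> - \<beta>\<bar>)) at_top"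
    by (simp add: primitive_points_small)
  then show ?thesis by simp
qed

lemma unit_power:
  obtains p q where "lin \<alpha> p q = e powi k" "lin \<beta> p q = e powi (- k)"
proof -
  have nat: "\<exists>p q. lin \<alpha> p q = e ^ n \<and> lin \<beta> p q = (1 / e) ^ n" for n
  proof (induction n)
    case 0
    show ?case by (rule exI[of _ 0], rule exI[of _ 1]) (simp add: lin_def)
  next
    case (Suc n)
    then obtain p q where "lin \<alpha> p q = e ^ n" "lin \<beta> p q = (1 / e) ^ n" by blast
    then have "lin \<alpha> p q * lin \<alpha> p0 q0 = e ^ Suc n" "lin \<beta> p q * lin \<beta> p0 q0 = (1 / e) ^ Suc n"
      using generator by simp_all
    then show ?case unfolding lin_mult lin_mult' by blast
  qed
  show thesis
  proof (cases "k \<ge> 0")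
    case True
    then obtain p q where "lin \<alpha> p q = e ^ nat k" "lin \<beta> p q = (1 / e) ^ nat k" using nat by blast
    then show thesis using True
      by (intro that[of p q]) (simp_all add: power_int_def power_inverse inverse_eq_divide)
  next
    case False
    then obtain p q where pq: "lin \<alpha> p q = e ^ nat (- k)" "lin \<beta> p q = (1 / e) ^ nat (- k)" using nat by blast
    have "lin \<alpha> (- p) (q + p * tr) = (1 / e) ^ nat (- k)" "lin \<beta> (- p) (q + p * tr) = e ^ nat (- k)"
      using pq lin_conj[of p q] by simp_all
    then show thesis using False
      by (intro that[of "- p" "q + p * tr"]) (simp_all add: power_int_def power_inverse inverse_eq_divide)
  qed
qed

text \<open>
Multiplication by \<open>e\<^sup>k\<close> multiplies \<open>\<bar>x / y\<bar>\<close> by \<open>e\<^bsup>2k\<^esup>\<close>; the right exponent is minus the integral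
part of the logarithm of \<open>\<bar>x / y\<bar>\<close> to base \<open>e\<^sup>2\<close>.
\<close>
lemma sector_representative:
  assumes "lin \<alpha> c d \<noteq> 0" "lin \<beta> c d \<noteq> 0"
  obtains p q where "lin \<alpha> p q * lin \<beta> p q = 1"
    "(lin \<alpha> c d * lin \<alpha> p q, lin \<beta> c d * lin \<beta> p q) \<in> sector e"
proof -
  let ?x = "lin \<alpha> c d" and ?y = "lin \<beta> c d"
  define l where "l = log (e\<^sup>2) (\<bar>?x\<bar> / \<bar>?y\<bar>)"
  have e2: "e\<^sup>2 > 1" using e_gt_1 by (simp add: one_less_power)
  have ratio: "(e\<^sup>2) powr l = \<bar>?x\<bar> / \<bar>?y\<bar>" unfolding l_def using assms e2 by (intro powr_log_cancel) auto
  have shift: "\<bar>?x\<bar> * (e\<^sup>2) powi (- \<lfloor>l\<rfloor>) = (e\<^sup>2) powr (l - of_int \<lfloor>l\<rfloor>) * \<bar>?y\<bar>"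
  proof -
    have "(e\<^sup>2) powr (l - of_int \<lfloor>l\<rfloor>) = (e\<^sup>2) powr l * (e\<^sup>2) powr (of_int (- \<lfloor>l\<rfloor>))"
      by (simp flip: powr_add)
    also have "(e\<^sup>2) powr (of_int (- \<lfloor>l\<rfloor>)) = (e\<^sup>2) powi (- \<lfloor>l\<rfloor>)"
      using e2 by (intro powr_real_of_int') auto
    finally show ?thesis using assms unfolding ratio by simp
  qed
  have frac: "1 \<le> (e\<^sup>2) powr (l - of_int \<lfloor>l\<rfloor>)" "(e\<^sup>2) powr (l - of_int \<lfloor>l\<rfloor>) < e\<^sup>2"
  proof -
    have "(e\<^sup>2) powr 0 \<le> (e\<^sup>2) powr (l - of_int \<lfloor>l\<rfloor>)" using e2 by (intro powr_mono) auto
    then show "1 \<le> (e\<^sup>2) powr (l - of_int \<lfloor>l\<rfloor>)" using e_gt_1 by simp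
    have "(e\<^sup>2) powr (l - of_int \<lfloor>l\<rfloor>) < (e\<^sup>2) powr 1" using e2 by (intro powr_less_mono) linarith+
    then show "(e\<^sup>2) powr (l - of_int \<lfloor>l\<rfloor>) < e\<^sup>2" using e2 by simp
  qed
  define k where "k = - \<lfloor>l\<rfloor>"
  define E where "E = e powi k"
  have E: "E > 0" "e powi (- k) = 1 / E" "(e\<^sup>2) powi k = E\<^sup>2"
    using e_gt_1 by (simp_all add: E_def power_int_minus inverse_eq_divide power_int_mult_distrib power2_eq_square)
  have k: "\<bar>?y\<bar> \<le> \<bar>?x\<bar> * E\<^sup>2" "\<bar>?x\<bar> * E\<^sup>2 < e\<^sup>2 * \<bar>?y\<bar>"
    using shift frac assms mult_right_mono[OF frac(1), of "\<bar>?y\<bar>"] mult_strict_right_mono[OF frac(2), of "\<bar>?y\<bar>"]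
    by (simp_all add: E(3)[symmetric] k_def)
  have bounds: "\<bar>?y\<bar> / E \<le> \<bar>?x\<bar> * E" "\<bar>?x\<bar> * E < e\<^sup>2 * (\<bar>?y\<bar> / E)"
    using k E(1) by (simp_all add: field_simps power2_eq_square)
  obtain p q where pq: "lin \<alpha> p q = E" "lin \<beta> p q = 1 / E" using unit_power[of k] E(2) E_def by metis
  show thesis
  proof (cases "?x > 0")
    case True
    show thesis
      by (rule that[of p q]) (use True pq bounds E in \<open>auto simp: sector_def abs_mult\<close>)
  next
    case False
    have neg: "lin z (- p) (- q) = - lin z p q" for z by (simp add: lin_def)
    show thesis
      by (rule that[of "- p" "- q"])
        (use False assms pq bounds E in \<open>auto simp: sector_def abs_mult neg mult_less_0_iff\<close>)
  qed
qed

text \<open>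
If multiplication by a unit \<open>E\<close> of norm \<open>1\<close> keeps a point inside the sector, then \<open>E\<close> is positive and
the ratio \<open>\<bar>x / y\<bar>\<close> changes by \<open>E\<^sup>2\<close>. Both ratios lie in \<open>[1, e\<^sup>2)\<close>, so \<open>E\<close> lies
strictly between \<open>1 / e\<close> and \<open>e\<close>, where \<open>1\<close> is the only such unit.
\<close>
lemma sector_representative_unique:
  assumes s: "(x, y) \<in> sector e" and s': "(x * lin \<alpha> p q, y * lin \<beta> p q) \<in> sector e"
    and unit: "lin \<alpha> p q * lin \<beta> p q = 1"
  shows "lin \<alpha> p q = 1"
proof -
  define E where "E = lin \<alpha> p q"
  have \<beta>: "lin \<beta> p q = 1 / E" using unit unfolding E_def by (metis mult_zero_left nonzero_mult_div_cancel_left zero_neq_one)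
  have x: "x > 0" "\<bar>y\<bar> \<le> x" "x < e\<^sup>2 * \<bar>y\<bar>" using s by (auto simp: sector_def)
  have "x * E > 0" using s' by (simp add: sector_def E_def)
  then have E: "E > 0" using x by (simp add: zero_less_mult_iff)
  have s2: "\<bar>y\<bar> / E \<le> x * E" "x * E < e\<^sup>2 * (\<bar>y\<bar> / E)" using s' E by (auto simp: sector_def \<beta> abs_mult E_def[symmetric])
  have y: "\<bar>y\<bar> > 0" using x by (auto simp: zero_less_mult_iff)
  have "x * E\<^sup>2 < e\<^sup>2 * \<bar>y\<bar>" using s2(2) E by (simp add: field_simps power2_eq_square)
  also have "\<dots> \<le> e\<^sup>2 * x" using x by (intro mult_left_mono) auto
  finally have "E\<^sup>2 < e\<^sup>2" using x by simp
  then have up: "E < e" using e_gt_1 by (auto dest: power_less_imp_less_base)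
  have "\<bar>y\<bar> \<le> x * E\<^sup>2" using s2(1) E by (simp add: field_simps power2_eq_square)
  also have "\<dots> < (e\<^sup>2 * \<bar>y\<bar>) * E\<^sup>2" using x E by (intro mult_strict_right_mono) auto
  finally have "1 * \<bar>y\<bar> < (e * E)\<^sup>2 * \<bar>y\<bar>" by (simp add: power_mult_distrib mult_ac)
  then have "1\<^sup>2 < (e * E)\<^sup>2" using y by simp
  then have "1 < e * E" using e_gt_1 E by (intro power_less_imp_less_base[of 1 2 "e * E"]) auto
  then have "1 / e < E" using e_gt_1 by (simp add: field_simps)
  then show ?thesis using minimal[OF unit] up by (simp add: E_def)
qed

text \<open>
The set counted in the theorem, restricted to the orbit of one of the two conjugates.
\<close>
definition classes :: "real \<Rightarrow> real set set" where
  "classes t = {w \<in> PSL2Z_orbit {\<alpha>}. inverse \<bar>w - galois_conj w\<bar> \<le> t} // mod_Z"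

text \<open>
A primitive row \<open>(c, d)\<close> is the bottom row of a matrix of determinant \<open>1\<close>, unique up to adding
multiples of \<open>(c, d)\<close> to the top row, which translates the image of \<open>\<alpha>\<close> by an integer. Hence the
row determines a class. Rows give the same class exactly when the elements
\<open>lin \<alpha> c d\<close> differ by a unit of norm \<open>1\<close>, and the sector contains one representative for each orbit
of these units. The distance condition becomes a bound on the norm by \<open>inverse_conj_distance\<close>.
\<close>
lemma primitive_points_bij_classes: "\<exists>f. bij_betw f (primitive_points (t * \<bar>\<alpha> - \<beta>\<bar>)) (classes t)"
proof -
  have "\<forall>c d :: int. \<exists>ab. coprime c d \<longrightarrow> fst ab * d - snd ab * c = 1"
  proof (intro allI)
    fix c d :: int
    obtain u v where "u * c + v * d = gcd c d" using bezout_int by blast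
    then show "\<exists>ab. coprime c d \<longrightarrow> fst ab * d - snd ab * c = 1"
      by (intro exI[of _ "(v, - u)"]) (auto simp: algebra_simps)
  qed
  then obtain ab where ab: "\<And>c d. coprime c d \<Longrightarrow> fst (ab c d) * d - snd (ab c d) * c = (1 :: int)" by metis
  \<comment> \<open>An arbitrary completion of each primitive row to a matrix of determinant \<open>1\<close>.\<close>
  define w where "w = (\<lambda>(c, d). lin \<alpha> (fst (ab c d)) (snd (ab c d)) / lin \<alpha> c d)"
  have shift: "lin \<alpha> a b + of_int k * lin \<alpha> c d = lin \<alpha> (a + k * c) (b + k * d)" for a b c d k
    by (simp add: lin_def algebra_simps)
  have delta: "\<bar>\<alpha> - \<beta>\<bar> > 0" using distinct by simp
  have bound: "inverse \<bar>z - galois_conj z\<bar> \<le> t \<longleftrightarrow> \<bar>lin \<alpha> c d * lin \<beta> c d\<bar> \<le> t * \<bar>\<alpha> - \<beta>\<bar>"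
    if "a * d - b * c = 1" "z = lin \<alpha> a b / lin \<alpha> c d" for a b c d z
    unfolding inverse_conj_distance[OF that] using delta by (simp add: pos_divide_le_eq)
  let ?f = "\<lambda>v. mod_Z `` {w v}"
  have "bij_betw ?f (primitive_points (t * \<bar>\<alpha> - \<beta>\<bar>)) (classes t)"
    unfolding bij_betw_def
  proof
    show "inj_on ?f (primitive_points (t * \<bar>\<alpha> - \<beta>\<bar>))"
    proof (rule inj_onI)
      fix v v' assume v: "v \<in> primitive_points (t * \<bar>\<alpha> - \<beta>\<bar>)" and v': "v' \<in> primitive_points (t * \<bar>\<alpha> - \<beta>\<bar>)"
        and "?f v = ?f v'"
      then have "w v - w v' \<in> \<int>" by (simp add: mod_Z_class_eq_iff)
      then obtain k :: int where k: "w v = w v' + of_int k" by (metis Ints_cases add_diff_cancel_left' diff_add_cancel add.commute)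
      obtain c d c' d' where cd: "v = (c, d)" "v' = (c', d')" by (cases v, cases v')
      obtain a b a' b' where abs: "ab c d = (a, b)" "ab c' d' = (a', b')" by (metis surj_pair)
      have det: "a * d - b * c = 1" "a' * d' - b' * c' = 1"
        using ab[of c d] ab[of c' d'] v v' abs by (auto simp: cd primitive_points_def)
      have det': "(a' + k * c') * d' - (b' + k * d') * c' = 1" using det(2) by (simp add: algebra_simps)
      have sec: "(lin \<alpha> c d, lin \<beta> c d) \<in> sector e" "(lin \<alpha> c' d', lin \<beta> c' d') \<in> sector e"
        using v v' by (auto simp: cd primitive_points_def points_def)
      have nz: "lin \<alpha> c d \<noteq> 0" "lin \<alpha> c' d' \<noteq> 0" using sec by (auto simp: sector_def)
      have "lin \<alpha> a b / lin \<alpha> c d = lin \<alpha> a' b' / lin \<alpha> c' d' + of_int k" using k by (simp add: w_def cd abs)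
      also have "\<dots> = lin \<alpha> (a' + k * c') (b' + k * d') / lin \<alpha> c' d'"
        using nz by (simp add: shift[symmetric] add_divide_distrib)
      finally have "lin \<alpha> a b * lin \<alpha> c' d' = lin \<alpha> (a' + k * c') (b' + k * d') * lin \<alpha> c d"
        using nz by (simp add: frac_eq_eq)
      from ratio_is_unit[OF det(1) det' _ _ this]
      obtain p q where pq: "lin \<alpha> c d = lin \<alpha> c' d' * lin \<alpha> p q" "lin \<beta> c d = lin \<beta> c' d' * lin \<beta> p q"
        "lin \<alpha> p q * lin \<beta> p q = 1" by auto
      have "lin \<alpha> p q = 1"
        using sector_representative_unique[OF sec(2) _ pq(3)] sec(1) unfolding pq(1,2) by blast
      then have "lin \<alpha> c d = lin \<alpha> c' d'" using pq(1) by simp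
      then show "v = v'" by (simp add: lin_eq_iff cd)
    qed
    show "?f ` primitive_points (t * \<bar>\<alpha> - \<beta>\<bar>) = classes t"
    proof (intro equalityI subsetI)
      fix K assume "K \<in> ?f ` primitive_points (t * \<bar>\<alpha> - \<beta>\<bar>)"
      then obtain c d where cd: "(c, d) \<in> primitive_points (t * \<bar>\<alpha> - \<beta>\<bar>)" "K = ?f (c, d)" by auto
      obtain a b where abs: "ab c d = (a, b)" by (metis surj_pair)
      have det: "a * d - b * c = 1" using ab[of c d] cd abs by (auto simp: primitive_points_def)
      have w: "w (c, d) = lin \<alpha> a b / lin \<alpha> c d" by (simp add: w_def abs)
      have "inverse \<bar>w (c, d) - galois_conj (w (c, d))\<bar> \<le> t"
        using bound[OF det w] cd(1) by (simp add: primitive_points_def points_def)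
      moreover have "w (c, d) \<in> PSL2Z_orbit {\<alpha>}" unfolding orbit_singleton using det w by blast
      ultimately show "K \<in> classes t" unfolding classes_def cd(2) by (intro quotientI) simp
    next
      fix K assume "K \<in> classes t"
      then obtain z where z: "z \<in> PSL2Z_orbit {\<alpha>}" "inverse \<bar>z - galois_conj z\<bar> \<le> t" "K = mod_Z `` {z}"
        unfolding classes_def by (auto elim: quotientE)
      obtain a b c d where det: "a * d - b * c = 1" and z_eq: "z = lin \<alpha> a b / lin \<alpha> c d"
        using z(1) unfolding orbit_singleton by blast
      have nz: "lin \<alpha> c d \<noteq> 0" "lin \<beta> c d \<noteq> 0" using det by (auto simp: lin_eq_0_iff lin_eq_0_iff')
      obtain p q where pq: "lin \<alpha> p q * lin \<beta> p q = 1"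
        "(lin \<alpha> c d * lin \<alpha> p q, lin \<beta> c d * lin \<beta> p q) \<in> sector e"
        using sector_representative[OF nz] .
      obtain a' b' c' d' where m:
        "lin \<alpha> a' b' = lin \<alpha> a b * lin \<alpha> p q" "lin \<alpha> c' d' = lin \<alpha> c d * lin \<alpha> p q"
        "lin \<beta> c' d' = lin \<beta> c d * lin \<beta> p q"
        "of_int (a' * d' - b' * c') = of_int (a * d - b * c) * (lin \<alpha> p q * lin \<beta> p q)"
        using multiply_by_unit[of a b p q c d] by metis
      have det': "a' * d' - b' * c' = 1" using m(4) unfolding pq det by linarith
      have "lin \<alpha> p q \<noteq> 0" using pq by auto
      then have z_eq': "z = lin \<alpha> a' b' / lin \<alpha> c' d'" unfolding z_eq m by simp
      have co: "coprime c' d'" using det' by (rule coprime_of_det_one)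
      have mem: "(c', d') \<in> primitive_points (t * \<bar>\<alpha> - \<beta>\<bar>)"
        using bound[OF det' z_eq'] z(2) pq(2) co by (simp add: primitive_points_def points_def m)
      obtain u v where uv: "ab c' d' = (u, v)" by (metis surj_pair)
      have det2: "u * d' - v * c' = 1" using ab[OF co] uv by simp
      \<comment> \<open>The two completions \<open>(a', b')\<close> and \<open>(u, v)\<close> of \<open>(c', d')\<close> differ by \<open>k\<close> times \<open>(c', d')\<close>, and their determinant is \<open>k\<close>.\<close>
      define k where "k = u * b' - a' * v"
      have "k * c' = u * (b' * c') - a' * (v * c')" by (simp add: k_def algebra_simps)
      also have "b' * c' = a' * d' - 1" using det' by simp
      also have "v * c' = u * d' - 1" using det2 by simp
      finally have k1: "a' = u + k * c'" by (simp add: algebra_simps)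
      have "k * d' = (u * d') * b' - (a' * d') * v" by (simp add: k_def algebra_simps)
      also have "u * d' = 1 + v * c'" using det2 by simp
      also have "a' * d' = 1 + b' * c'" using det' by simp
      finally have k2: "b' = v + k * d'" by (simp add: algebra_simps)
      have "lin \<alpha> c' d' \<noteq> 0" using co by (auto simp: lin_eq_0_iff)
      then have "z = w (c', d') + of_int k"
        unfolding z_eq' k1 k2 shift[symmetric] by (simp add: w_def uv add_divide_distrib)
      then have "K = ?f (c', d')" unfolding z(3) mod_Z_class_eq_iff by simp
      then show "K \<in> ?f ` primitive_points (t * \<bar>\<alpha> - \<beta>\<bar>)" using mem by blast
    qed
  qed
  then show ?thesis by blast
qed

lemma finite_classes: "finite (classes t)"
  using primitive_points_bij_classes[of t] finite_points bij_betw_finite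
  by (metis primitive_points_def finite_Int)

lemma classes_asymptotics: "((\<lambda>t. real (card (classes t)) / t) \<longlongrightarrow> 12 * ln e / pi\<^sup>2) at_top"
proof -
  have delta: "\<bar>\<alpha> - \<beta>\<bar> > 0" using distinct by simp
  have card_eq: "card (classes t) = card (primitive_points (t * \<bar>\<alpha> - \<beta>\<bar>))" for t
    using primitive_points_bij_classes[of t] bij_betw_same_card by metis
  have "filterlim (\<lambda>t. t * \<bar>\<alpha> - \<beta>\<bar>) at_top at_top"
    using filterlim_tendsto_pos_mult_at_top[OF tendsto_const delta filterlim_ident] by (simp add: mult.commute)
  from filterlim_compose[OF primitive_points_asymptotics this]
  have "((\<lambda>t. real (card (classes t)) / (t * \<bar>\<alpha> - \<beta>\<bar>) * \<bar>\<alpha> - \<beta>\<bar>)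
      \<longlongrightarrow> 12 * ln e / (pi\<^sup>2 * \<bar>\<alpha> - \<beta>\<bar>) * \<bar>\<alpha> - \<beta>\<bar>) at_top"
    unfolding card_eq by (rule tendsto_mult[OF _ tendsto_const])
  then show ?thesis using delta by simp
qed

end

section \<open>The two orbits and Pell's equation\<close>

context conjugate_pair
begin

text \<open>
Multiplying both rows by a unit of norm \<open>- 1\<close> does not move the image of \<open>\<alpha>\<close> but gives a matrix
of determinant \<open>- 1\<close>. The substitution \<open>\<alpha> = tr - \<beta>\<close> has determinant \<open>- 1\<close> too, and the
composite is a matrix of determinant \<open>1\<close> applied to \<open>\<beta>\<close>.
\<close>
lemma orbit_subset_of_unit:
  assumes "lin \<alpha> p q * lin \<beta> p q = - 1"
  shows "PSL2Z_orbit {\<alpha>} \<subseteq> PSL2Z_orbit {\<beta>}"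
proof
  fix w assume "w \<in> PSL2Z_orbit {\<alpha>}"
  then obtain a b c d where det: "a * d - b * c = 1" and w: "w = lin \<alpha> a b / lin \<alpha> c d"
    unfolding orbit_singleton by blast
  obtain a' b' c' d' where m:
    "lin \<alpha> a' b' = lin \<alpha> a b * lin \<alpha> p q" "lin \<alpha> c' d' = lin \<alpha> c d * lin \<alpha> p q"
    "of_int (a' * d' - b' * c') = of_int (a * d - b * c) * (lin \<alpha> p q * lin \<beta> p q)"
    using multiply_by_unit[of a b p q c d] by metis
  have "lin \<alpha> p q \<noteq> 0" using assms by auto
  then have "w = lin \<alpha> a' b' / lin \<alpha> c' d'" unfolding w m by simp
  also have "\<dots> = lin \<beta> (- a') (b' + a' * tr) / lin \<beta> (- c') (d' + c' * tr)"
    by (simp add: lin_conj(2))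
  finally have w': "w = lin \<beta> (- a') (b' + a' * tr) / lin \<beta> (- c') (d' + c' * tr)" .
  have "a' * d' - b' * c' = - 1" using m(3) unfolding assms det by linarith
  then have "(- a') * (d' + c' * tr) - (b' + a' * tr) * (- c') = 1" by (simp add: algebra_simps)
  then show "w \<in> PSL2Z_orbit {\<beta>}" using w' unfolding orbit_singleton by blast
qed

text \<open>
Conversely, substituting \<open>\<beta> = tr - \<alpha>\<close> writes \<open>w'\<close> as the image of \<open>\<alpha>\<close> under a matrix of
determinant \<open>- 1\<close>, and \<open>w\<close> is its image under one of determinant \<open>1\<close>.
\<close>
lemma unit_of_orbits_meeting:
  assumes "w \<in> PSL2Z_orbit {\<alpha>}" "w' \<in> PSL2Z_orbit {\<beta>}" "w - w' \<in> \<int>"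
  obtains p q where "lin \<alpha> p q * lin \<beta> p q = - 1"
proof -
  obtain a b c d where det: "a * d - b * c = 1" and w: "w = lin \<alpha> a b / lin \<alpha> c d"
    using assms(1) unfolding orbit_singleton by blast
  obtain a' b' c' d' where det': "a' * d' - b' * c' = 1" and w': "w' = lin \<beta> a' b' / lin \<beta> c' d'"
    using assms(2) unfolding orbit_singleton by blast
  obtain k :: int where k: "w - w' = of_int k" using assms(3) by (auto elim: Ints_cases)
  have nz: "lin \<alpha> c d \<noteq> 0" "lin \<beta> c' d' \<noteq> 0" using det det' by (auto simp: lin_eq_0_iff lin_eq_0_iff')
  have "w = w' + of_int k" using k by simp
  also have "\<dots> = lin \<beta> (a' + k * c') (b' + k * d') / lin \<beta> c' d'"
    using nz by (simp add: w' lin_def field_simps)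
  finally have "lin \<alpha> a b / lin \<alpha> c d = lin \<beta> (a' + k * c') (b' + k * d') / lin \<beta> c' d'" by (simp add: w)
  then have eq: "lin \<alpha> a b * lin \<alpha> (- c') (d' + c' * tr)
     = lin \<alpha> (- (a' + k * c')) ((b' + k * d') + (a' + k * c') * tr) * lin \<alpha> c d"
    using nz unfolding lin_conj(1) by (simp add: frac_eq_eq)
  have "(- (a' + k * c')) * (d' + c' * tr) - ((b' + k * d') + (a' + k * c') * tr) * (- c') = - (a' * d' - b' * c')"
    by (simp add: algebra_simps)
  then have "(- (a' + k * c')) * (d' + c' * tr) - ((b' + k * d') + (a' + k * c') * tr) * (- c') = - 1"
    using det' by simp
  from ratio_is_unit[OF det this _ _ eq] that show thesis by auto
qed

lemma has_unit_of_norm_minus_one_iff: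
  "has_unit_of_norm_minus_one (order_of \<alpha>) \<longleftrightarrow> (\<exists>p q. lin \<alpha> p q * lin \<beta> p q = - 1)"
proof
  assume "has_unit_of_norm_minus_one (order_of \<alpha>)"
  then obtain u where u: "u \<in> order_of \<alpha>" "Nm u = - 1" unfolding has_unit_of_norm_minus_one_def by blast
  then obtain a b :: int where "u = of_int a + of_int b * \<alpha>" unfolding order_of_def by blast
  then have "u = lin \<alpha> b a" by (simp add: lin_def)
  then show "\<exists>p q. lin \<alpha> p q * lin \<beta> p q = - 1"
    using u(2) by (auto simp: Nm_def galois_conj_lin)
next
  assume "\<exists>p q. lin \<alpha> p q * lin \<beta> p q = - 1"
  then obtain p q where pq: "lin \<alpha> p q * lin \<beta> p q = - 1" by blast
  have mem: "lin \<alpha> x y \<in> order_of \<alpha>" for x y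
    unfolding order_of_def lin_def by (auto simp: add.commute)
  have neg: "- lin \<beta> p q = lin \<alpha> p (- (q + p * tr))"
    unfolding lin_conj(1) by (simp add: lin_def)
  have "lin \<alpha> p q * lin \<alpha> p (- (q + p * tr)) = 1" using pq unfolding neg[symmetric] by simp
  moreover have "Nm (lin \<alpha> p q) = - 1" using pq by (simp add: Nm_def galois_conj_lin)
  ultimately show "has_unit_of_norm_minus_one (order_of \<alpha>)"
    unfolding has_unit_of_norm_minus_one_def using mem by blast
qed

end

lemma quadratic_integer_conjugate_pair:
  assumes "a \<notin> \<rat>" "quadratic_integer a"
  obtains tr nm where "conjugate_pair a (galois_conj a) tr nm"
proof -
  obtain b c :: int where bc: "a\<^sup>2 + of_int b * a + of_int c = 0" using assms(2) by (auto simp: quadratic_integer_def)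
  have "conjugate_pair a (- of_int b - a) (- b) c"
    using assms(1) bc by unfold_locales (simp_all add: algebra_simps power2_eq_square)
  moreover from this have "galois_conj a = - of_int b - a" by (rule conjugate_pair.galois_conj_alpha)
  ultimately show thesis using that by metis
qed

text \<open>
A unit \<open>lin \<alpha> p q\<close> of norm \<open>1\<close> and its inverse have the integral sum \<open>t\<close> and the difference
\<open>p (\<alpha> - \<beta>)\<close>, where \<open>\<bar>\<alpha> - \<beta>\<bar> = sqrt D\<close>; so \<open>(t, \<bar>p\<bar>)\<close> solves Pell's equation. If the unit lies
strictly between \<open>1 / e\<close> and \<open>e\<close>, then \<open>\<bar>p\<bar> < u\<close>, and the choice of \<open>u\<close> forces \<open>p = 0\<close>.
\<close>
lemma (in conjugate_pair) pell_norm_one_generator: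
  assumes D: "D = (\<alpha> - \<beta>)\<^sup>2" and fund: "fundamental_pell_solution D t u"
    and e: "e = (of_int t + of_int u * sqrt D) / 2"
  shows "\<exists>p q. norm_one_generator \<alpha> \<beta> tr nm e p q"
proof -
  have tu: "t > 0" "u > 0" "(of_int t)\<^sup>2 - D * (of_int u)\<^sup>2 = (4 :: real)"
    and least: "\<And>t' u'. t' > 0 \<Longrightarrow> u' > 0 \<Longrightarrow> pell_solution D t' u' \<Longrightarrow> u \<le> u'"
    using fund by (auto simp: fundamental_pell_solution_def pell_solution_def)
  have sq: "sqrt D = \<bar>\<alpha> - \<beta>\<bar>" unfolding D by simp
  \<comment> \<open>The sign makes \<open>lin \<alpha> p q\<close>, and not its conjugate, equal to \<open>e\<close> for either ordering of \<open>\<alpha>\<close> and \<open>\<beta>\<close>.\<close>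
  define sg :: int where "sg = (if \<alpha> > \<beta> then 1 else - 1)"
  have sg: "of_int sg * (\<alpha> - \<beta>) = sqrt D" "sg * sg = 1" unfolding sq by (auto simp: sg_def)
  have D_int: "D = of_int (tr * tr - 4 * nm)"
  proof -
    have "D = (\<alpha> + \<beta>) * (\<alpha> + \<beta>) - 4 * (\<alpha> * \<beta>)" by (simp add: D power2_eq_square algebra_simps)
    then show ?thesis unfolding trace norm by simp
  qed
  have "of_int (t * t - (tr * tr - 4 * nm) * (u * u)) = (of_int 4 :: real)"
    using tu(3) unfolding D_int by (simp add: power2_eq_square)
  then have pell: "t * t - (tr * tr - 4 * nm) * (u * u) = 4" by (simp only: of_int_eq_iff)
  have "even (t - sg * u * tr)"
  proof -
    have "t * t = 4 + (tr * tr - 4 * nm) * (u * u)" using pell by simp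
    then have "even (t * t) \<longleftrightarrow> even ((tr * tr - 4 * nm) * (u * u))" by simp
    then show ?thesis by (auto simp: sg_def)
  qed
  then obtain q where q: "t - sg * u * tr = 2 * q" by (elim evenE)
  define p where "p = sg * u"
  have tq: "of_int t = of_int p * (\<alpha> + \<beta>) + 2 * (of_int q :: real)"
  proof -
    have "t = p * tr + 2 * q" using q by (simp add: p_def)
    then show ?thesis unfolding trace by simp
  qed
  have pu: "of_int p * (\<alpha> - \<beta>) = of_int u * sqrt D" by (simp add: p_def sg(1)[symmetric])
  have lin1: "lin \<alpha> p q = e"
    unfolding e using tq pu by (simp add: lin_def algebra_simps)
  have lin2: "lin \<beta> p q = (of_int t - of_int u * sqrt D) / 2"
    using tq pu by (simp add: lin_def algebra_simps)
  have D0: "D > 0" using distinct by (simp add: D)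
  have prod: "lin \<alpha> p q * lin \<beta> p q = 1"
  proof -
    have "lin \<alpha> p q * lin \<beta> p q = ((of_int t)\<^sup>2 - (sqrt D)\<^sup>2 * (of_int u)\<^sup>2) / 4"
      unfolding lin1 lin2 e by (simp add: power2_eq_square field_simps)
    then show ?thesis using tu(3) D0 by simp
  qed
  have e0: "e > 0" unfolding e using tu D0 by (intro divide_pos_pos add_pos_pos mult_pos_pos) auto
  have lin2': "lin \<beta> p q = 1 / e" using prod e0 unfolding lin1 by (simp add: field_simps)
  have diff: "e - 1 / e = of_int u * sqrt D" unfolding lin2'[symmetric] lin2 unfolding e by (simp add: field_simps)
  have "0 < of_int u * sqrt D" using tu D0 by simp
  then have "1 / e < e" using diff by linarith
  have e1: "e > 1"
  proof (rule ccontr)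
    assume "\<not> e > 1"
    then have "1 \<le> 1 / e" using e0 by simp
    then show False using \<open>1 / e < e\<close> \<open>\<not> e > 1\<close> by linarith
  qed
  have "norm_one_generator \<alpha> \<beta> tr nm e p q"
  proof unfold_locales
    fix p' q' assume unit: "lin \<alpha> p' q' * lin \<beta> p' q' = 1" and lo: "1 / e < lin \<alpha> p' q'" and hi: "lin \<alpha> p' q' < e"
    let ?E = "lin \<alpha> p' q'"
    have E0: "?E > 0" using lo e0 by (meson less_trans zero_less_divide_1_iff)
    have \<beta>E: "lin \<beta> p' q' = 1 / ?E" using unit E0 by (simp add: field_simps)
    have inv: "1 / e < 1 / ?E" "1 / ?E < e" using lo hi E0 e0 by (simp_all add: field_simps)
    define t' where "t' = p' * tr + 2 * q'"
    have t': "of_int t' = ?E + lin \<beta> p' q'"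
    proof -
      have "?E + lin \<beta> p' q' = of_int p' * (\<alpha> + \<beta>) + 2 * of_int q'" by (simp add: lin_def algebra_simps)
      then show ?thesis unfolding trace t'_def by simp
    qed
    have "(0 :: real) < of_int t'" unfolding t' \<beta>E using E0 by (intro add_pos_pos) auto
    then have t'0: "t' > 0" by simp
    have pd: "of_int p' * (\<alpha> - \<beta>) = ?E - lin \<beta> p' q'" by (simp add: lin_def algebra_simps)
    have "of_int \<bar>p'\<bar> * sqrt D = \<bar>?E - 1 / ?E\<bar>"
      unfolding sq \<beta>E[symmetric] pd[symmetric] by (simp add: abs_mult)
    also have "\<dots> < of_int u * sqrt D" unfolding diff[symmetric] using inv lo hi by linarith
    finally have "\<bar>p'\<bar> < u" using D0 by (simp add: mult_less_cancel_right)
    moreover have "pell_solution D t' \<bar>p'\<bar>"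
    proof -
      have "(of_int t')\<^sup>2 - D * (of_int \<bar>p'\<bar>)\<^sup>2 = (?E + lin \<beta> p' q')\<^sup>2 - (of_int p' * (\<alpha> - \<beta>))\<^sup>2"
        unfolding t' D by (simp add: power_mult_distrib)
      also have "\<dots> = 4 * (?E * lin \<beta> p' q')" unfolding pd by (simp add: power2_eq_square algebra_simps)
      finally show ?thesis unfolding unit pell_solution_def by simp
    qed
    ultimately have "p' = 0" using least[OF t'0, of "\<bar>p'\<bar>"] by (cases "p' = 0") auto
    then have "?E = of_int q'" "of_int q' * of_int q' = (1 :: real)" using unit by (simp_all add: lin_def)
    then have "?E\<^sup>2 = 1\<^sup>2" by (simp add: power2_eq_square)
    then show "?E = 1" using E0 by (simp only: power2_eq_iff) linarith
  qed (use e1 lin1 lin2' in auto)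
  then show ?thesis by blast
qed

lemma orbit_union: "PSL2Z_orbit {x, y} = PSL2Z_orbit {x} \<union> PSL2Z_orbit {y}"
  by (auto simp: PSL2Z_orbit_def)

lemma quotient_Un: "(A \<union> B) // r = A // r \<union> B // r"
  by (auto simp: quotient_def)

theorem mainTheorem4:
  fixes \<alpha>\<^sub>0 D \<epsilon>\<^sub>0 R\<^sub>0 n\<^sub>0 :: real and t\<^sub>0 u\<^sub>0 :: int
  assumes "\<alpha>\<^sub>0 \<notin> \<rat>" and "quadratic_integer \<alpha>\<^sub>0"
    and "D = disc \<alpha>\<^sub>0"
    and "fundamental_pell_solution D t\<^sub>0 u\<^sub>0"
    and "\<epsilon>\<^sub>0 = (of_int t\<^sub>0 + of_int u\<^sub>0 * sqrt D) / 2"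
    and "R\<^sub>0 = ln \<epsilon>\<^sub>0"
    and "n\<^sub>0 = (if has_unit_of_norm_minus_one (order_of \<alpha>\<^sub>0) then 2 else 1)"
  shows "(\<lambda>t :: real. real (card
              ({\<alpha> \<in> PSL2Z_orbit {\<alpha>\<^sub>0, galois_conj \<alpha>\<^sub>0}.
                  inverse \<bar>\<alpha> - galois_conj \<alpha>\<bar> \<le> t} // mod_Z)))
         \<sim>[at_top] (\<lambda>t. 24 * R\<^sub>0 / (pi\<^sup>2 * n\<^sub>0) * t)"
proof -
  define \<beta> where "\<beta> = galois_conj \<alpha>\<^sub>0"
  obtain tr nm where "conjugate_pair \<alpha>\<^sub>0 (galois_conj \<alpha>\<^sub>0) tr nm"
    using quadratic_integer_conjugate_pair[OF assms(1,2)] by blast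
  then interpret A: conjugate_pair \<alpha>\<^sub>0 \<beta> tr nm unfolding \<beta>_def .
  interpret B: conjugate_pair \<beta> \<alpha>\<^sub>0 tr nm by (rule A.swap)
  have D: "D = (\<alpha>\<^sub>0 - \<beta>)\<^sup>2" "D = (\<beta> - \<alpha>\<^sub>0)\<^sup>2"
    unfolding assms(3) disc_def Tr_def Nm_def \<beta>_def[symmetric] by (simp_all add: power2_eq_square algebra_simps)
  obtain p q where "norm_one_generator \<alpha>\<^sub>0 \<beta> tr nm \<epsilon>\<^sub>0 p q"
    using A.pell_norm_one_generator[OF D(1) assms(4,5)] by blast
  then interpret GA: norm_one_generator \<alpha>\<^sub>0 \<beta> tr nm \<epsilon>\<^sub>0 p q .
  obtain p' q' where "norm_one_generator \<beta> \<alpha>\<^sub>0 tr nm \<epsilon>\<^sub>0 p' q'"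
    using B.pell_norm_one_generator[OF D(2) assms(4,5)] by blast
  then interpret GB: norm_one_generator \<beta> \<alpha>\<^sub>0 tr nm \<epsilon>\<^sub>0 p' q' .
  let ?c = "\<lambda>t. card ({\<alpha> \<in> PSL2Z_orbit {\<alpha>\<^sub>0, \<beta>}. inverse \<bar>\<alpha> - galois_conj \<alpha>\<bar> \<le> t} // mod_Z)"
  have split: "{\<alpha> \<in> PSL2Z_orbit {\<alpha>\<^sub>0, \<beta>}. inverse \<bar>\<alpha> - galois_conj \<alpha>\<bar> \<le> t} // mod_Z
      = GA.classes t \<union> GB.classes t" for t
    unfolding GA.classes_def GB.classes_def quotient_Un[symmetric] orbit_union
    by (rule arg_cong[of _ _ "\<lambda>S. S // mod_Z"]) auto
  have lim: "((\<lambda>t. real (?c t) / t) \<longlongrightarrow> 24 * R\<^sub>0 / (pi\<^sup>2 * n\<^sub>0)) at_top"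
  proof (cases "has_unit_of_norm_minus_one (order_of \<alpha>\<^sub>0)")
    case True
    then obtain x y where xy: "lin \<alpha>\<^sub>0 x y * lin \<beta> x y = - 1" unfolding A.has_unit_of_norm_minus_one_iff by blast
    have "PSL2Z_orbit {\<alpha>\<^sub>0} = PSL2Z_orbit {\<beta>}"
      using A.orbit_subset_of_unit[OF xy] B.orbit_subset_of_unit[of x y] xy by (simp add: mult.commute)
    then have "GA.classes t = GB.classes t" for t unfolding GA.classes_def GB.classes_def by simp
    then have "?c t = card (GA.classes t)" for t unfolding split by simp
    then show ?thesis using GA.classes_asymptotics True by (simp add: assms(6,7))
  next
    case False
    have disj: "GA.classes t \<inter> GB.classes t = {}" for t
    proof (rule ccontr)
      assume "GA.classes t \<inter> GB.classes t \<noteq> {}"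
      then obtain K where "K \<in> GA.classes t" "K \<in> GB.classes t" by blast
      then obtain w w' where w: "w \<in> PSL2Z_orbit {\<alpha>\<^sub>0}" "w' \<in> PSL2Z_orbit {\<beta>}" "mod_Z `` {w} = mod_Z `` {w'}"
        unfolding GA.classes_def GB.classes_def by (auto elim!: quotientE)
      then have "w - w' \<in> \<int>" by (simp add: mod_Z_class_eq_iff)
      with w A.unit_of_orbits_meeting have "\<exists>x y. lin \<alpha>\<^sub>0 x y * lin \<beta> x y = - 1" by metis
      then show False using False unfolding A.has_unit_of_norm_minus_one_iff by blast
    qed
    have "real (?c t) / t = real (card (GA.classes t)) / t + real (card (GB.classes t)) / t" for t
      unfolding split using card_Un_disjoint[OF GA.finite_classes GB.finite_classes disj]
      by (simp add: add_divide_distrib)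
    then have "((\<lambda>t. real (?c t) / t) \<longlongrightarrow> 12 * ln \<epsilon>\<^sub>0 / pi\<^sup>2 + 12 * ln \<epsilon>\<^sub>0 / pi\<^sup>2) at_top"
      using tendsto_add[OF GA.classes_asymptotics GB.classes_asymptotics] by simp
    then show ?thesis using False by (simp add: assms(6,7))
  qed
  define C where "C = 24 * R\<^sub>0 / (pi\<^sup>2 * n\<^sub>0)"
  have C: "C \<noteq> 0" using GA.e_gt_1 by (simp add: C_def assms(6,7))
  have "((\<lambda>t. real (?c t) / (C * t)) \<longlongrightarrow> 1) at_top"
  proof -
    have "((\<lambda>t. real (?c t) / t / C) \<longlongrightarrow> C / C) at_top"
      by (intro tendsto_divide lim[folded C_def] tendsto_const C)
    then show ?thesis using C by (simp add: mult.commute)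
  qed
  then show ?thesis
    unfolding \<beta>_def[symmetric] C_def[symmetric]
    by (rule asymp_equivI') 
qed

end
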